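(* Let $S_1$ and $S_2$ be closed, smooth, genus-0 surfaces without boundary, embedded in $\mathbb{R}^3$ and both contained in $(0,1)^3$. Then for every $\epsilon>0$ there exist $m,n,o\in\mathbb{N}$ and functions $\alpha_{ijk}:[0,1]\to\mathbb{R}^3$, for $i=0,\dots,m$, $j=0,\dots,n$, $k=0,\dots,o$, such that $$CD\big(\boldsymbol{G}_{\boldsymbol{\alpha}}(S_1),S_2\big)\le\epsilon$$ and $$\alpha_{ijk}(t)=0\quad\text{for all } t\in[0,1]\quad\text{whenever } i(m-i)\,j(n-j)\,k(o-k)=0 .$$
   Context: $\mathbb{N}$ denotes the positive integers. For $m\in\mathbb{N}$ and $0\le i\le m$, the univariate Bernstein polynomials are $b_{m,i}(x)=\binom{m}{i}x^i(1-x)^{m-i}$, and the trivariate ones are $B_{(i,j,k),(m,n,o)}(x,y,z)=b_{m,i}(x)\,b_{n,j}(y)\,b_{o,k}(z)$. For a family $\boldsymbol{\delta}=(\delta_{ijk})$ with $\delta_{ijk}\in\mathbb{R}^3$, $0\le i\le m$, $0\le j\le n$, $0\le k\le o$, the Free Form Deformation (FFD) map is $$\boldsymbol{F}_{\boldsymbol{\delta}}(x,y,z)=\sum_{i=0}^m\sum_{j=0}^n\sum_{k=0}^o\delta_{ijk}\,B_{(i,j,k),(m,n,o)}(x,y,z).$$ For time-dependent coefficients $\boldsymbol{\alpha}(t)=(\alpha_{ijk}(t))$, $t\in[0,1]$, $\boldsymbol{G}_{\boldsymbol{\alpha}}(\boldsymbol{x})$ denotes the value at time $t=1$ of the solution of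 the ODE $\dot{\boldsymbol{x}}(t)=\boldsymbol{F}_{\boldsymbol{\alpha}(t)}(\boldsymbol{x}(t))$ with initial condition $\boldsymbol{x}(0)=\boldsymbol{x}$, and $\boldsymbol{G}_{\boldsymbol{\alpha}}(S_1)$ is the image of $S_1$. The Chamfer distance of two surfaces $S,S'\subset\mathbb{R}^3$ is $$CD(S,S')=\frac12\,\frac{\int_{S}\big(\min_{y\in S'}\|x-y\|\big)^2dS(x)}{\int_{S}1\,dS(x)}+\frac12\,\frac{\int_{S'}\big(\min_{y\in S}\|x-y\|\big)^2dS(x)}{\int_{S'}1\,dS(x)},$$ where $\|\cdot\|$ is the Euclidean norm and $dS$ is surface measure. *)

theory Defs
  imports "HOL-Analysis.Analysis"
begin

section \<open>Smooth closed surfaces of genus 0 in three-space\<close>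

text \<open>
  Continuous differentiability of order \<open>k\<close> on an open set, by iterating directional
  derivatives; only meant for open \<open>U\<close>, since derivatives are taken at full neighbourhoods.
\<close>

primrec Ck_on :: "nat \<Rightarrow> 'a::real_normed_vector set \<Rightarrow> ('a \<Rightarrow> 'b::real_normed_vector) \<Rightarrow> bool" where
  "Ck_on 0 U f \<longleftrightarrow> continuous_on U f"
| "Ck_on (Suc k) U f \<longleftrightarrow>
     (\<forall>x\<in>U. f differentiable (at x)) \<and>
     (\<forall>v. Ck_on k U (\<lambda>x. frechet_derivative f (at x) v))"

definition smooth_on :: "'a::real_normed_vector set \<Rightarrow> ('a \<Rightarrow> 'b::real_normed_vector) \<Rightarrow> bool" where
  "smooth_on U f \<longleftrightarrow> (\<forall>k. Ck_on k U f)"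

definition local_parametrization ::
  "(real^3) set \<Rightarrow> (real^2) set \<Rightarrow> (real^2 \<Rightarrow> real^3) \<Rightarrow> bool" where
  "local_parametrization S U \<phi> \<longleftrightarrow>
     open U \<and> smooth_on U \<phi> \<and>
     (\<forall>u\<in>U. inj (frechet_derivative \<phi> (at u))) \<and>
     openin (top_of_set S) (\<phi> ` U) \<and>
     (\<exists>\<psi>. homeomorphism U (\<phi> ` U) \<phi> \<psi>)"

text \<open>
  Embedded surfaces in the sense of classical differential geometry.  Since the domains of the
  parametrizations are open in the plane, there is no boundary.
\<close>

definition smooth_surface :: "(real^3) set \<Rightarrow> bool" where
  "smooth_surface S \<longleftrightarrow> (\<forall>p\<in>S. \<exists>U \<phi>. local_parametrization S U \<phi> \<and> p \<in> \<phi> ` U)"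

definition closed_smooth_surface :: "(real^3) set \<Rightarrow> bool" where
  "closed_smooth_surface S \<longleftrightarrow> compact S \<and> smooth_surface S"

text \<open>A closed surface has genus 0 iff it is a topological sphere (no handles attached).\<close>

definition genus_zero :: "(real^3) set \<Rightarrow> bool" where
  "genus_zero S \<longleftrightarrow> S homeomorphic sphere (0::real^3) 1"

section \<open>Surface measure and Chamfer distance\<close>

definition area_element :: "(real^2 \<Rightarrow> real^3) \<Rightarrow> real^2 \<Rightarrow> real" where
  "area_element \<phi> u =
     norm (cross3 (frechet_derivative \<phi> (at u) (axis 1 1))
                  (frechet_derivative \<phi> (at u) (axis 2 1)))"

text \<open>
  The surface measure is characterised by the area formula in every local parametrization.
  For a closed smooth surface such a Borel measure exists and is unique: the local area formulas
  agree on overlaps by the change-of-variables theorem, and countably many parametrizations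
  cover the surface.
\<close>

definition surface_measure :: "(real^3) set \<Rightarrow> (real^3) measure" where
  "surface_measure S = (THE M.
     sets M = sets (restrict_space borel S) \<and>
     (\<forall>U \<phi> B. local_parametrization S U \<phi> \<and> B \<in> sets borel \<and> B \<subseteq> U \<longrightarrow>
        emeasure M (\<phi> ` B) = (\<integral>\<^sup>+u\<in>B. ennreal (area_element \<phi> u) \<partial>lborel)))"

text \<open>
  For a nonempty compact \<open>S'\<close>, the value \<open>infdist x S'\<close> is the minimum of the distances from
  \<open>x\<close> to the points of \<open>S'\<close>.
\<close>

definition chamfer_dist :: "(real^3) set \<Rightarrow> (real^3) set \<Rightarrow> real" where
  "chamfer_dist S S' =
     1/2 * ((LINT x:S|surface_measure S. (infdist x S')\<^sup>2) / (LINT x:S|surface_measure S. 1)) +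
     1/2 * ((LINT x:S'|surface_measure S'. (infdist x S)\<^sup>2) / (LINT x:S'|surface_measure S'. 1))"

section \<open>Free form deformations and their flows\<close>

definition ffd ::
  "nat \<Rightarrow> nat \<Rightarrow> nat \<Rightarrow> (nat \<Rightarrow> nat \<Rightarrow> nat \<Rightarrow> real^3) \<Rightarrow> real^3 \<Rightarrow> real^3" where
  "ffd m n l \<delta> x =
     (\<Sum>i\<le>m. \<Sum>j\<le>n. \<Sum>k\<le>l.
        (Bernstein m i (x$1) * Bernstein n j (x$2) * Bernstein l k (x$3)) *\<^sub>R \<delta> i j k)"

definition ffd_solution ::
  "nat \<Rightarrow> nat \<Rightarrow> nat \<Rightarrow> (nat \<Rightarrow> nat \<Rightarrow> nat \<Rightarrow> real \<Rightarrow> real^3) \<Rightarrow> real^3 \<Rightarrow> (real \<Rightarrow> real^3) \<Rightarrow> bool" where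
  "ffd_solution m n l \<alpha> x u \<longleftrightarrow>
     u 0 = x \<and>
     (\<forall>t\<in>{0..1}. (u has_vector_derivative ffd m n l (\<lambda>i j k. \<alpha> i j k t) (u t)) (at t within {0..1}))"

definition ffd_well_posed ::
  "nat \<Rightarrow> nat \<Rightarrow> nat \<Rightarrow> (nat \<Rightarrow> nat \<Rightarrow> nat \<Rightarrow> real \<Rightarrow> real^3) \<Rightarrow> real^3 \<Rightarrow> bool" where
  "ffd_well_posed m n l \<alpha> x \<longleftrightarrow>
     (\<exists>u. ffd_solution m n l \<alpha> x u \<and>
          (\<forall>v. ffd_solution m n l \<alpha> x v \<longrightarrow> (\<forall>t\<in>{0..1}. v t = u t)))"

text \<open>The time-one map; meaningful at the points \<open>x\<close> with \<open>ffd_well_posed m n l \<alpha> x\<close>.\<close>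

definition ffd_flow ::
  "nat \<Rightarrow> nat \<Rightarrow> nat \<Rightarrow> (nat \<Rightarrow> nat \<Rightarrow> nat \<Rightarrow> real \<Rightarrow> real^3) \<Rightarrow> real^3 \<Rightarrow> real^3" where
  "ffd_flow m n l \<alpha> x = (THE y. \<exists>u. ffd_solution m n l \<alpha> x u \<and> u 1 = y)"

end

theory Submission
  imports Defs
begin

text \<open>
  An average of squared distances is at most the square of their supremum, so it suffices to make
  the image of \<open>S\<^sub>1\<close> and the surface \<open>S\<^sub>2\<close> close in the Hausdorff distance; no isotopy between the two
  surfaces is needed. Contract \<open>S\<^sub>1\<close> inside the cube into a small ball around a point of \<open>S\<^sub>2\<close>. Then
  flow within a neighbourhood \<open>V\<close> of \<open>S\<^sub>2\<close>, which is open and connected, so that finitely many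
  points of the contracted surface are moved one after the other onto a finite net of \<open>S\<^sub>2\<close>; the flow
  preserves \<open>V\<close>, so the rest of the surface stays close to \<open>S\<^sub>2\<close>. The controlling vector field
  \<open>X t x\<close> vanishes off the open cube and is Lipschitz in \<open>x\<close>. Its Bernstein coefficients
  \<open>X t (i/n, j/n, k/n)\<close> are continuous in \<open>t\<close>, vanish at the boundary indices, and give an FFD field
  within \<open>O(1/sqrt n)\<close> of \<open>X\<close>, so Gronwall's inequality transfers the closeness.
\<close>

section \<open>Trajectories of Lipschitz vector fields\<close>

text \<open>The squared distance plus \<open>e\<^sup>2\<close>, weighted by exp(-(2L+1)t), is
  nonincreasing: its growth is controlled by Cauchy-Schwarz and 2|w|e \<le> |w|^2 + e^2. Squares
  avoid differentiating the norm where \<open>u\<close> and \<open>v\<close> meet. With e = 0 this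
  yields uniqueness, with e > 0 it compares the flows of two nearby fields.\<close>

lemma gronwall_forward:
  fixes u v :: "real \<Rightarrow> 'a::real_inner"
  assumes ab: "a \<le> b" and L: "0 \<le> L"
    and u: "\<And>t. t \<in> {a..b} \<Longrightarrow> (u has_vector_derivative u' t) (at t within {a..b})"
    and v: "\<And>t. t \<in> {a..b} \<Longrightarrow> (v has_vector_derivative v' t) (at t within {a..b})"
    and le: "\<And>t. t \<in> {a..b} \<Longrightarrow> norm (u' t - v' t) \<le> L * norm (u t - v t) + e"
  shows "(norm (u b - v b))\<^sup>2 \<le> ((norm (u a - v a))\<^sup>2 + e\<^sup>2) * exp ((2 * L + 1) * (b - a))"
proof -
  define K where "K = 2 * L + 1"
  define G where "G t = ((u t - v t) \<bullet> (u t - v t) + e\<^sup>2) * exp (- K * t)" for t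
  have d: "((\<lambda>t. u t - v t) has_vector_derivative (u' t - v' t)) (at t within {a..b})" if "t \<in> {a..b}" for t
    by (intro has_vector_derivative_diff u v that)
  have cont: "continuous_on {a..b} (\<lambda>t. u t - v t)"
    unfolding continuous_on_eq_continuous_within
    by (blast intro: d has_vector_derivative_continuous)
  have "G a \<ge> G b"
  proof (rule DERIV_nonpos_imp_decreasing_open[OF ab])
    show "continuous_on {a..b} G"
      unfolding G_def by (intro continuous_intros cont)
    fix t assume t: "a < t" "t < b"
    define w w' where "w = u t - v t" and "w' = u' t - v' t"
    have "((\<lambda>t. u t - v t) has_vector_derivative w') (at t)"
      using d[of t] t at_within_interior[of t "{a..b}"] by (simp add: w'_def)
    then have "((\<lambda>t. (u t - v t) \<bullet> (u t - v t)) has_derivative (\<lambda>h. w \<bullet> (h *\<^sub>R w') + (h *\<^sub>R w') \<bullet> w)) (at t)"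
      unfolding w_def has_vector_derivative_def by (intro has_derivative_inner)
    then have "((\<lambda>t. (u t - v t) \<bullet> (u t - v t)) has_real_derivative 2 * (w \<bullet> w')) (at t)"
      unfolding has_field_derivative_def
      by (rule has_derivative_eq_rhs) (auto simp: fun_eq_iff inner_commute algebra_simps)
    then have "(G has_real_derivative 2 * (w \<bullet> w') * exp (- K * t) + - K * exp (- K * t) * (w \<bullet> w + e\<^sup>2)) (at t)"
      unfolding G_def w_def
      by (auto intro!: derivative_eq_intros)
    moreover have "2 * (w \<bullet> w') * exp (- K * t) + - K * exp (- K * t) * (w \<bullet> w + e\<^sup>2) \<le> 0"
    proof -
      have "2 * (w \<bullet> w') \<le> 2 * (norm w * norm w')"
        using norm_cauchy_schwarz[of w w'] by simp
      also have "\<dots> \<le> 2 * (norm w * (L * norm w + e))"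
        using le[of t] t by (intro mult_left_mono) (auto simp: w_def w'_def)
      also have "\<dots> \<le> 2 * L * (norm w)\<^sup>2 + ((norm w)\<^sup>2 + e\<^sup>2)"
        using sum_squares_bound[of "norm w" e] by (simp add: algebra_simps power2_eq_square)
      also have "\<dots> \<le> K * (w \<bullet> w + e\<^sup>2)"
        using L by (simp add: K_def power2_norm_eq_inner algebra_simps)
      finally have "(2 * (w \<bullet> w') - K * (w \<bullet> w + e\<^sup>2)) * exp (- K * t) \<le> 0"
        by (simp add: mult_nonpos_nonneg)
      then show ?thesis by (simp add: algebra_simps)
    qed
    ultimately show "\<exists>y. DERIV G t :> y \<and> y \<le> 0" by blast
  qed
  then have "G b * exp (K * b) \<le> G a * exp (K * b)"
    by simp
  moreover have "G b * exp (K * b) = (norm (u b - v b))\<^sup>2 + e\<^sup>2"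
    by (simp add: G_def power2_norm_eq_inner exp_minus)
  moreover have "G a * exp (K * b) = ((norm (u a - v a))\<^sup>2 + e\<^sup>2) * exp (K * (b - a))"
    by (simp add: G_def power2_norm_eq_inner right_diff_distrib exp_diff exp_minus divide_inverse)
  ultimately show ?thesis
    unfolding K_def using zero_le_power2[of e] by linarith
qed

text \<open>Vanishing off the open time interval lets fields be run one after the other without a
  jump in time. Vanishing off \<open>W\<close> makes every point outside \<open>W\<close>
  stationary, which traps the other trajectories in \<open>W\<close>.\<close>

definition control :: "'a::euclidean_space set \<Rightarrow> real \<Rightarrow> (real \<Rightarrow> 'a \<Rightarrow> 'a) \<Rightarrow> bool" where
  "control W L X \<longleftrightarrow> 0 < L \<and> (\<forall>x. continuous_on UNIV (\<lambda>t. X t x)) \<and>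
     (\<forall>t x y. norm (X t x - X t y) \<le> L * norm (x - y)) \<and>
     (\<forall>t x. t \<notin> {0<..<1} \<or> x \<notin> W \<longrightarrow> X t x = 0)"

lemma controlD:
  assumes "control W L X"
  shows "0 < L" "continuous_on UNIV (\<lambda>t. X t x)" "norm (X t x - X t y) \<le> L * norm (x - y)"
    "t \<notin> {0<..<1} \<Longrightarrow> X t x = 0" "x \<notin> W \<Longrightarrow> X t x = 0"
  using assms unfolding control_def by auto

lemma control_mono: "control W L X \<Longrightarrow> W \<subseteq> W' \<Longrightarrow> control W' L X"
  unfolding control_def by blast

text \<open>The Lipschitz constant does not depend on time, so separate continuity suffices: compare
  \<open>X t (u t)\<close> with \<open>X t (u s)\<close>, and that with
  \<open>X s (u s)\<close>.\<close>

lemma continuous_on_control: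
  assumes X: "control W L X" and u: "continuous_on UNIV u"
  shows "continuous_on UNIV (\<lambda>t. X t (u t))"
proof -
  have "((\<lambda>t. X t (u t)) \<longlongrightarrow> X s (u s)) (at s)" for s
  proof -
    have "(u \<longlongrightarrow> u s) (at s)" "((\<lambda>t. X t (u s)) \<longlongrightarrow> X s (u s)) (at s)"
      using u controlD(2)[OF X, of "u s"] by (auto simp: continuous_on_def)
    then have "((\<lambda>t. L * norm (u t - u s) + norm (X t (u s) - X s (u s))) \<longlongrightarrow> L * norm (u s - u s) + norm (X s (u s) - X s (u s))) (at s)"
      by (intro tendsto_intros)
    then have lim: "((\<lambda>t. L * norm (u t - u s) + norm (X t (u s) - X s (u s))) \<longlongrightarrow> 0) (at s)"
      by simp
    have "norm (X t (u t) - X s (u s)) \<le> L * norm (u t - u s) + norm (X t (u s) - X s (u s))" for t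
      using controlD(3)[OF X, of t "u t" "u s"] norm_triangle_ineq[of "X t (u t) - X t (u s)" "X t (u s) - X s (u s)"]
      by simp
    then have "((\<lambda>t. X t (u t) - X s (u s)) \<longlongrightarrow> 0) (at s)"
      by (intro tendsto_0_le[OF lim, where K=1] always_eventually) (simp add: order_trans[OF _ abs_ge_self])
    then show ?thesis by (simp add: LIM_zero_iff)
  qed
  then show ?thesis by (simp add: continuous_on_def)
qed

definition trajectory :: "(real \<Rightarrow> 'a \<Rightarrow> 'a) \<Rightarrow> (real \<Rightarrow> 'a::real_normed_vector) \<Rightarrow> bool" where
  "trajectory X u \<longleftrightarrow> (\<forall>t. (u has_vector_derivative X t (u t)) (at t))"

text \<open>Agreement at one time propagates in both directions: forwards by Gronwall with zero
  error, backwards by the same estimate for the time-reversed curves.\<close>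

lemma trajectory_unique:
  assumes X: "control W L X" and u: "trajectory X u" and v: "trajectory X v" and eq: "u s = v s"
  shows "u t = v t"
proof -
  note L = less_imp_le[OF controlD(1)[OF X]]
  show ?thesis
  proof (cases "s \<le> t")
    case True
    have "(norm (u t - v t))\<^sup>2 \<le> ((norm (u s - v s))\<^sup>2 + 0\<^sup>2) * exp ((2 * L + 1) * (t - s))"
      using u v controlD(3)[OF X] unfolding trajectory_def
      by (intro gronwall_forward[where u' = "\<lambda>t. X t (u t)" and v' = "\<lambda>t. X t (v t)"] True L)
         (auto intro: has_vector_derivative_at_within)
    then show ?thesis using eq by simp
  next
    case False
    have rev: "((\<lambda>t. w (- t)) has_vector_derivative - X (- t) (w (- t))) (at t within A)"
      if "trajectory X w" for w A t
    proof -
      have "(w \<circ> uminus has_vector_derivative (-1) *\<^sub>R X (- t) (w (- t))) (at t)"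
        using that unfolding trajectory_def
        by (intro vector_diff_chain_at) (auto intro!: derivative_eq_intros)
      then show ?thesis by (simp add: o_def has_vector_derivative_at_within)
    qed
    have "(norm (u (- (- t)) - v (- (- t))))\<^sup>2 \<le> ((norm (u (- (- s)) - v (- (- s))))\<^sup>2 + 0\<^sup>2) * exp ((2 * L + 1) * (- t - - s))"
      using False controlD(3)[OF X]
      by (intro gronwall_forward[where u' = "\<lambda>t. - X (- t) (u (- t))" and v' = "\<lambda>t. - X (- t) (v (- t))"] L rev u v)
         (auto simp: norm_minus_commute)
    then show ?thesis using eq by simp
  qed
qed

lemma trajectory_const:
  assumes "control W L X" "x \<notin> W"
  shows "trajectory X (\<lambda>_. x)"
  using controlD(5)[OF assms] by (auto simp: trajectory_def intro!: derivative_eq_intros)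

text \<open>A trajectory that meets a point outside \<open>W\<close> coincides with the constant
  trajectory there, so it was never in \<open>W\<close>.\<close>

lemma trajectory_stays:
  assumes "control W L X" "trajectory X u" "u s \<in> W"
  shows "u t \<in> W"
  using trajectory_unique[OF assms(1,2) trajectory_const[OF assms(1)], of "u t" t s] assms(3) by metis

lemma trajectory_outside:
  assumes X: "control W L X" and u: "trajectory X u"
  shows "t \<le> 0 \<Longrightarrow> u t = u 0" "1 \<le> t \<Longrightarrow> u t = u 1"
proof -
  have d: "(u has_derivative (\<lambda>h. 0)) (at s within A)" if "s \<notin> {0<..<1}" for s A
  proof -
    have "(u has_vector_derivative 0) (at s)"
      using u controlD(4)[OF X that] unfolding trajectory_def by metis
    then show ?thesis
      unfolding has_vector_derivative_def by (simp add: has_derivative_at_withinI)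
  qed
  show "u t = u 0" if "t \<le> 0"
  proof -
    have "\<exists>c. \<forall>s\<in>{..0::real}. u s = c"
      by (rule has_derivative_zero_constant) (auto intro!: d)
    then show ?thesis using that by auto
  qed
  show "u t = u 1" if "1 \<le> t"
  proof -
    have "\<exists>c. \<forall>s\<in>{1::real..}. u s = c"
      by (rule has_derivative_zero_constant) (auto intro!: d)
    then show ?thesis using that by auto
  qed
qed

text \<open>Picard iteration in an exponentially weighted norm: the unknown is \<open>w\<close> with
  u(t) = exp(Kt) w(t), and the choice K = 2L makes the integral operator a contraction with factor
  1/2 on the whole interval at once. Working on [-1,2] keeps [0,1] in the interior, so that
  derivatives at 0 and 1 are two-sided.\<close>

lemma trajectory_exists:
  fixes X :: "real \<Rightarrow> 'a \<Rightarrow> 'a::euclidean_space"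
  assumes X: "control W L X"
  shows "\<exists>u. trajectory X u \<and> u 0 = x"
proof -
  define K where "K = 2 * L"
  have L: "0 < L" and K: "0 < K" using controlD(1)[OF X] by (auto simp: K_def)
  define h where "h w s = X s (exp (K * s) *\<^sub>R w s)" for w :: "real \<Rightarrow>\<^sub>C 'a" and s
  define F where "F w t = exp (- K * t) *\<^sub>R (x + integral {-1..t} (h w))" for w t
  have h: "continuous_on A (h w)" for w A
    unfolding h_def by (rule continuous_on_subset[OF continuous_on_control[OF X]]) (auto intro!: continuous_intros)
  have int: "h w integrable_on {-1..t}" for w t
    by (rule integrable_continuous_real[OF h])
  have F: "continuous_on (cbox (-1) 2) (F w)" for w
    unfolding F_def using indefinite_integral_continuous_1[OF int[of w 2]]
    by (intro continuous_intros) simp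
  \<comment> \<open>Clamping the argument extends the Picard image constantly beyond [-1,2], so the
    iteration acts on the complete space of bounded continuous functions on the line.\<close>
  have "\<exists>g :: real \<Rightarrow>\<^sub>C 'a. \<forall>t. g t = F w (clamp (-1) 2 t)" for w
    using continuous_on_cbox_bcontfunE[OF F[of w]] by metis
  then obtain T :: "(real \<Rightarrow>\<^sub>C 'a) \<Rightarrow> (real \<Rightarrow>\<^sub>C 'a)" where T: "\<And>w t. T w t = F w (clamp (-1) 2 t)"
    by metis
  have contr: "dist (F w t) (F v t) \<le> 1/2 * dist w v" if t: "t \<in> {-1..2}" for w v t
  proof -
    have "norm (integral {-1..t} (\<lambda>s. h w s - h v s)) \<le> integral {-1..t} (\<lambda>s. L * dist w v * exp (K * s))"
    proof (rule integral_norm_bound_integral)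
      show "(\<lambda>s. h w s - h v s) integrable_on {- 1..t}"
        by (intro integrable_diff int)
      show "(\<lambda>s. L * dist w v * exp (K * s)) integrable_on {- 1..t}"
        by (intro integrable_continuous_real continuous_intros)
      show "norm (h w s - h v s) \<le> L * dist w v * exp (K * s)" for s
      proof -
        have "norm (h w s - h v s) \<le> L * norm (exp (K * s) *\<^sub>R (w s - v s))"
          unfolding h_def scaleR_diff_right by (rule controlD(3)[OF X])
        also have "\<dots> = L * exp (K * s) * dist (w s) (v s)"
          by (simp add: dist_norm)
        also have "\<dots> \<le> L * exp (K * s) * dist w v"
          using L by (intro mult_left_mono dist_bounded) auto
        finally show ?thesis by (simp add: mult_ac)
      qed
    qed
    also have "((\<lambda>s. L * dist w v * exp (K * s)) has_integral
        (L * dist w v * exp (K * t) / K - L * dist w v * exp (K * (-1)) / K)) {-1..t}"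
      using K t by (intro fundamental_theorem_of_calculus)
        (auto intro!: derivative_eq_intros simp flip: has_real_derivative_iff_has_vector_derivative)
    then have "integral {-1..t} (\<lambda>s. L * dist w v * exp (K * s)) =
        L * dist w v * exp (K * t) / K - L * dist w v * exp (K * (-1)) / K"
      by (rule integral_unique)
    also have "\<dots> \<le> L * dist w v * exp (K * t) / K"
      using L K by simp
    also have "\<dots> = 1/2 * dist w v * exp (K * t)"
      using L by (simp add: K_def)
    finally have *: "norm (integral {-1..t} (\<lambda>s. h w s - h v s)) \<le> 1/2 * dist w v * exp (K * t)" .
    have "dist (F w t) (F v t) = exp (- K * t) * norm (integral {-1..t} (\<lambda>s. h w s - h v s))"
      by (simp add: F_def dist_norm Henstock_Kurzweil_Integration.integral_diff[OF int int] flip: scaleR_diff_right)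
    also have "\<dots> \<le> exp (- K * t) * (1/2 * dist w v * exp (K * t))"
      by (intro mult_left_mono *) simp
    also have "\<dots> = 1/2 * dist w v"
      by (simp add: exp_minus)
    finally show ?thesis .
  qed
  have cl: "clamp (-1) 2 t \<in> {-1..2::real}" for t :: real
    using clamp_in_interval[of "-1::real" 2 t] by simp
  have "\<exists>!w. T w = w"
  proof (rule banach_fix_type[where c = "1/2"])
    have "dist (T w t) (T v t) \<le> 1/2 * dist w v" for w v t
      unfolding T by (rule contr[OF cl])
    then show "\<forall>w v. dist (T w) (T v) \<le> 1/2 * dist w v"
      by (blast intro: dist_bound)
  qed auto
  then obtain w where w: "T w = w" by auto
  have fix_eq: "exp (K * t) *\<^sub>R w t = x + integral {-1..t} (h w)" if "t \<in> {-1..2}" for t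
  proof -
    have "w t = F w t"
      using T[of w t] that w clamp_cancel_cbox[of t "-1" 2] by simp
    then show ?thesis by (simp add: F_def exp_minus)
  qed
  \<comment> \<open>The fixed point equation is known on [-1,2] only. Since the field rests off the
    open unit interval, constants continue the solution to all times; the integral formula below
    shows that the pieces fit at 0 and 1.\<close>
  define u where "u t = (if t < 0 then x else if t > 1 then x + integral {-1..1} (h w) else exp (K * t) *\<^sub>R w t)" for t
  have z: "h w t = 0" if "t \<notin> {0<..<1}" for t
    unfolding h_def by (rule controlD(4)[OF X that])
  have iz: "integral {a..b} (h w) = 0" if "b \<le> 0 \<or> 1 \<le> a" for a b
    by (intro integral_unique has_integral_is_0 z) (use that in auto)
  have u: "u t = x + integral {-1..t} (h w)" if "t \<in> {-1..2}" for t
  proof -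
    consider "t < 0" | "t > 1" | "t \<in> {0..1}" by force
    then show ?thesis
    proof cases
      case 1
      then show ?thesis using iz[of t "-1"] by (simp add: u_def)
    next
      case 2
      then show ?thesis
        using iz[of t 1] Henstock_Kurzweil_Integration.integral_combine[OF _ _ int, of 1 t w] by (simp add: u_def)
    next
      case 3
      then show ?thesis using fix_eq[of t] by (simp add: u_def)
    qed
  qed
  have "(u has_vector_derivative X t (u t)) (at t)" for t
  proof -
    consider "t < 0" | "t > 1" | "t \<in> {0..1}" by force
    then show ?thesis
    proof cases
      case 1
      have "((\<lambda>_. x) has_vector_derivative X t (u t)) (at t)"
        using 1 controlD(4)[OF X, of t] by (auto intro!: derivative_eq_intros)
      then show ?thesis
        by (rule has_vector_derivative_transform_within_open[where S = "{..<0}"]) (use 1 in \<open>auto simp: u_def\<close>)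
    next
      case 2
      have "((\<lambda>_. x + integral {-1..1} (h w)) has_vector_derivative X t (u t)) (at t)"
        using 2 controlD(4)[OF X, of t] by (auto intro!: derivative_eq_intros)
      then show ?thesis
        by (rule has_vector_derivative_transform_within_open[where S = "{1<..}"]) (use 2 in \<open>auto simp: u_def\<close>)
    next
      case 3
      have "((\<lambda>t. x + integral {-1..t} (h w)) has_vector_derivative h w t) (at t within {-1..2})"
        using integral_has_vector_derivative[OF h, of t "-1" 2 w] 3
        by (auto intro!: derivative_eq_intros)
      then have "((\<lambda>t. x + integral {-1..t} (h w)) has_vector_derivative h w t) (at t)"
        using 3 at_within_interior[of t "{-1..2}"] by simp
      then have "(u has_vector_derivative h w t) (at t)"
        by (rule has_vector_derivative_transform_within_open[where S = "{-1<..<2}"]) (use 3 in \<open>auto simp: u\<close>)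
      moreover have "h w t = X t (u t)"
        using 3 by (simp add: h_def u_def)
      ultimately show ?thesis by simp
    qed
  qed
  moreover have "u 0 = x"
    using u[of 0] iz[of 0 "-1"] by simp
  ultimately show ?thesis unfolding trajectory_def by blast
qed

section \<open>Maps steered by a compactly supported flow\<close>

text \<open>Trajectories of a control field are unique, so \<open>\<phi>\<close> is the time-one map
  of its flow.\<close>

definition steer :: "'a::euclidean_space set \<Rightarrow> ('a \<Rightarrow> 'a) \<Rightarrow> bool" where
  "steer W \<phi> \<longleftrightarrow> (\<exists>L X. control W L X \<and> (\<forall>x. \<exists>u. trajectory X u \<and> u 0 = x \<and> u 1 = \<phi> x))"

lemma steer_mono: "steer W \<phi> \<Longrightarrow> W \<subseteq> W' \<Longrightarrow> steer W' \<phi>"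
  unfolding steer_def by (meson control_mono)

lemma control_imp_steer:
  assumes X: "control W L X"
  obtains \<phi> where "steer W \<phi>" "\<And>u. trajectory X u \<Longrightarrow> \<phi> (u 0) = u 1"
proof -
  obtain U where U: "\<And>x. trajectory X (U x)" "\<And>x. U x 0 = x"
    using trajectory_exists[OF X] by metis
  show ?thesis
  proof (rule that)
    show "steer W (\<lambda>x. U x 1)"
      unfolding steer_def using X U by (intro exI[of _ L] exI[of _ X] conjI allI) auto
    show "U (u 0) 1 = u 1" if "trajectory X u" for u
      using trajectory_unique[OF X U(1) that] U(2) by blast
  qed
qed

lemma steer_id: "steer W (\<lambda>x. x)"
proof -
  have "control W 1 (\<lambda>_ _. 0)"
    by (auto simp: control_def)
  moreover have "\<exists>u. trajectory (\<lambda>_ _. 0) u \<and> u 0 = x \<and> u 1 = x" for x :: 'a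
    by (rule exI[of _ "\<lambda>_. x"]) (simp add: trajectory_def)
  ultimately show ?thesis
    unfolding steer_def by (intro exI[of _ "1::real"] exI[of _ "\<lambda>_ _. 0"] conjI allI)
qed

lemma steerE:
  assumes "steer W \<phi>"
  obtains L X where "control W L X" "\<forall>x. \<exists>u. trajectory X u \<and> u 0 = x \<and> u 1 = \<phi> x"
proof -
  from assms obtain L X where
    "control W L X \<and> (\<forall>x. \<exists>u. trajectory X u \<and> u 0 = x \<and> u 1 = \<phi> x)"
    unfolding steer_def by (elim exE)
  then show ?thesis by (elim conjE) (rule that)
qed

text \<open>Trajectories that meet at time 1 already agree at time 0.\<close>

lemma steer_inj:
  assumes "steer W \<phi>"
  shows "inj \<phi>"
proof (rule injI)
  obtain L X where X: "control W L X" and \<phi>: "\<forall>x. \<exists>u. trajectory X u \<and> u 0 = x \<and> u 1 = \<phi> x"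
    using assms by (rule steerE)
  fix x y assume eq: "\<phi> x = \<phi> y"
  from \<phi> obtain u where u: "trajectory X u" "u 0 = x" "u 1 = \<phi> x"
    by (elim allE[of _ x] exE conjE)
  from \<phi> obtain v where v: "trajectory X v" "v 0 = y" "v 1 = \<phi> y"
    by (elim allE[of _ y] exE conjE)
  show "x = y"
    using trajectory_unique[OF X u(1) v(1), of 1 0] eq u v by simp
qed

lemma steer_fixes:
  assumes "steer W \<phi>" "x \<notin> W"
  shows "\<phi> x = x"
proof -
  obtain L X where X: "control W L X" and \<phi>: "\<forall>x. \<exists>u. trajectory X u \<and> u 0 = x \<and> u 1 = \<phi> x"
    using assms(1) by (rule steerE)
  from \<phi> obtain u where "trajectory X u" "u 0 = x" "u 1 = \<phi> x"
    by (elim allE[of _ x] exE conjE)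
  then show ?thesis
    using trajectory_unique[OF X _ trajectory_const[OF X assms(2)], of u 0 1] by simp
qed

lemma steer_maps:
  assumes "steer W \<phi>" "x \<in> W"
  shows "\<phi> x \<in> W"
proof -
  obtain L X where X: "control W L X" and \<phi>: "\<forall>x. \<exists>u. trajectory X u \<and> u 0 = x \<and> u 1 = \<phi> x"
    using assms(1) by (rule steerE)
  from \<phi> obtain u where "trajectory X u" "u 0 = x" "u 1 = \<phi> x"
    by (elim allE[of _ x] exE conjE)
  then show ?thesis
    using trajectory_stays[OF X, of u 0 1] assms(2) by simp
qed

text \<open>Both fields are run at double speed, the first on the first half of the unit interval
  and the second on the other half. Each vanishes outside its own half, so the sum is again
  continuous in time.\<close>

lemma steer_comp:
  assumes "steer W \<phi>" "steer W \<psi>"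
  shows "steer W (\<psi> \<circ> \<phi>)"
proof -
  obtain L X where X: "control W L X" and u: "\<forall>x. \<exists>u. trajectory X u \<and> u 0 = x \<and> u 1 = \<phi> x"
    using assms(1) by (rule steerE)
  obtain M Y where Y: "control W M Y" and v: "\<forall>x. \<exists>u. trajectory Y u \<and> u 0 = x \<and> u 1 = \<psi> x"
    using assms(2) by (rule steerE)
  define Z where "Z t x = 2 *\<^sub>R X (2 * t) x + 2 *\<^sub>R Y (2 * t - 1) x" for t x
  have "control W (2 * L + 2 * M) Z"
    unfolding control_def
  proof (intro conjI allI impI)
    show "0 < 2 * L + 2 * M" using controlD(1)[OF X] controlD(1)[OF Y] by simp
    show "continuous_on UNIV (\<lambda>t. Z t x)" for x
      unfolding Z_def
      by (intro continuous_intros continuous_on_compose2[OF controlD(2)[OF X]] continuous_on_compose2[OF controlD(2)[OF Y]]) auto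
    show "norm (Z t x - Z t y) \<le> (2 * L + 2 * M) * norm (x - y)" for t x y
    proof -
      have "Z t x - Z t y = 2 *\<^sub>R (X (2 * t) x - X (2 * t) y) + 2 *\<^sub>R (Y (2 * t - 1) x - Y (2 * t - 1) y)"
        by (simp add: Z_def algebra_simps)
      then have "norm (Z t x - Z t y) \<le> 2 * norm (X (2 * t) x - X (2 * t) y) + 2 * norm (Y (2 * t - 1) x - Y (2 * t - 1) y)"
        using norm_triangle_ineq[of "2 *\<^sub>R (X (2 * t) x - X (2 * t) y)" "2 *\<^sub>R (Y (2 * t - 1) x - Y (2 * t - 1) y)"] by simp
      also have "\<dots> \<le> 2 * (L * norm (x - y)) + 2 * (M * norm (x - y))"
        using controlD(3)[OF X] controlD(3)[OF Y] by (intro add_mono mult_left_mono) auto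
      finally show ?thesis by (simp add: algebra_simps)
    qed
    show "Z t x = 0" if "t \<notin> {0<..<1} \<or> x \<notin> W" for t x
      using that controlD(4,5)[OF X] controlD(4,5)[OF Y] by (auto simp: Z_def)
  qed
  moreover have "\<exists>w. trajectory Z w \<and> w 0 = x \<and> w 1 = \<psi> (\<phi> x)" for x
  proof -
    from u obtain u where u: "trajectory X u" "u 0 = x" "u 1 = \<phi> x"
      by (elim allE[of _ x] exE conjE)
    from v obtain v where v: "trajectory Y v" "v 0 = \<phi> x" "v 1 = \<psi> (\<phi> x)"
      by (elim allE[of _ "\<phi> x"] exE conjE)
    \<comment> \<open>Up to time 1/2 the curve \<open>v\<close> still rests at
      \<open>\<phi> x\<close>, so \<open>w\<close> follows \<open>u\<close>; from then on
      \<open>u\<close> rests at \<open>\<phi> x\<close>, so \<open>w\<close> follows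
      \<open>v\<close>. One formula replaces gluing two curves.\<close>
    define w where "w t = u (2 * t) + v (2 * t - 1) - \<phi> x" for t
    have "(w has_vector_derivative Z t (w t)) (at t)" for t
    proof -
      have "(u \<circ> (\<lambda>t. 2 * t) has_vector_derivative 2 *\<^sub>R X (2 * t) (u (2 * t))) (at t)"
        using u(1) unfolding trajectory_def
        by (intro vector_diff_chain_at) (auto intro!: derivative_eq_intros)
      moreover have "(v \<circ> (\<lambda>t. 2 * t - 1) has_vector_derivative 2 *\<^sub>R Y (2 * t - 1) (v (2 * t - 1))) (at t)"
        using v(1) unfolding trajectory_def
        by (intro vector_diff_chain_at) (auto intro!: derivative_eq_intros)
      ultimately have "(w has_vector_derivative
          2 *\<^sub>R X (2 * t) (u (2 * t)) + 2 *\<^sub>R Y (2 * t - 1) (v (2 * t - 1)) - 0) (at t)"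
        unfolding w_def o_def by (intro has_vector_derivative_add has_vector_derivative_diff has_vector_derivative_const)
      moreover have "X (2 * t) (u (2 * t)) = X (2 * t) (w t)"
      proof (cases "t < 1/2")
        case True
        then show ?thesis
          using trajectory_outside(1)[OF Y v(1), of "2 * t - 1"] by (simp add: w_def v)
      qed (use controlD(4)[OF X] in simp)
      moreover have "Y (2 * t - 1) (v (2 * t - 1)) = Y (2 * t - 1) (w t)"
      proof (cases "t > 1/2")
        case True
        then show ?thesis
          using trajectory_outside(2)[OF X u(1), of "2 * t"] by (simp add: w_def u)
      qed (use controlD(4)[OF Y] in simp)
      ultimately show ?thesis by (simp add: Z_def)
    qed
    then have "trajectory Z w" by (simp add: trajectory_def)
    moreover have "w 0 = x"
      using trajectory_outside(1)[OF Y v(1), of "-1"] by (simp add: w_def u v)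
    moreover have "w 1 = \<psi> (\<phi> x)"
      using trajectory_outside(2)[OF X u(1), of 2] by (simp add: w_def u v)
    ultimately show ?thesis by (intro exI[of _ w] conjI)
  qed
  ultimately show ?thesis
    unfolding steer_def comp_def by (intro exI[of _ "2 * L + 2 * M"] exI[of _ Z] conjI allI)
qed

section \<open>Time reparametrization and spatial cutoff of autonomous fields\<close>

text \<open>Building block of a C^1 clock that is constant outside the unit interval. At the kink
  the difference quotient is bounded by |h|.\<close>

lemma has_real_derivative_positive_part_square:
  "((\<lambda>t::real. (max 0 (t - a))\<^sup>2) has_real_derivative 2 * max 0 (t - a)) (at t)"
proof -
  consider "t < a" | "t > a" | "t = a" by linarith
  then show ?thesis
  proof cases
    case 1
    have "((\<lambda>t. 0) has_real_derivative 2 * max 0 (t - a)) (at t)"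
      using 1 by (auto intro!: derivative_eq_intros)
    then show ?thesis
      by (rule has_field_derivative_transform_within_open[where S = "{..<a}"]) (use 1 in auto)
  next
    case 2
    have "((\<lambda>t. (t - a)\<^sup>2) has_real_derivative 2 * max 0 (t - a)) (at t)"
      using 2 by (auto intro!: derivative_eq_intros)
    then show ?thesis
      by (rule has_field_derivative_transform_within_open[where S = "{a<..}"]) (use 2 in auto)
  next
    case 3
    have "((\<lambda>h. (max 0 (a + h - a))\<^sup>2 / h) \<longlongrightarrow> 0) (at 0)"
    proof (rule Lim_null_comparison)
      show "\<forall>\<^sub>F h in at (0::real). norm ((max 0 (a + h - a))\<^sup>2 / h) \<le> \<bar>h\<bar>"
        by (auto simp: power2_eq_square max_def)
      show "((\<lambda>h. \<bar>h\<bar>) \<longlongrightarrow> (0::real)) (at 0)"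
        by (rule tendsto_rabs_zero) auto
    qed
    then show ?thesis
      by (simp add: 3 DERIV_def)
  qed
qed

text \<open>
  An autonomous field is run on the clock \<open>\<tau>\<close>, which stands still outside the unit interval,
  so that fields can be concatenated without losing continuity in time.
\<close>

lemma steer_autonomous:
  fixes Y :: "'a \<Rightarrow> 'a::euclidean_space"
  assumes lip: "\<And>x y. norm (Y x - Y y) \<le> L * norm (x - y)" and zero: "\<And>x. x \<notin> W \<Longrightarrow> Y x = 0"
  shows "\<exists>\<phi>. steer W \<phi> \<and>
    (\<forall>v. (\<forall>s\<in>{0..1}. (v has_vector_derivative Y (v s)) (at s)) \<longrightarrow> \<phi> (v 0) = v 1)"
proof -
  \<comment> \<open>This quadratic spline is 0 before time 0, then 2t^2 up to 1/2, then 1 - 2(1-t)^2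
    up to 1, and 1 afterwards. Its derivative is the tent of height 2 on [0,1].\<close>
  define \<tau> where "\<tau> t = 2 * ((max 0 (t - 0))\<^sup>2 - 2 * (max 0 (t - 1/2))\<^sup>2 + (max 0 (t - 1))\<^sup>2)" for t :: real
  define \<tau>' where "\<tau>' t = 4 * (max 0 t - 2 * max 0 (t - 1/2) + max 0 (t - 1))" for t :: real
  have \<tau>: "(\<tau> has_real_derivative \<tau>' t) (at t)" for t
    unfolding \<tau>_def \<tau>'_def
    by (rule derivative_eq_intros has_real_derivative_positive_part_square refl | simp)+
  have \<tau>'_bounds: "0 \<le> \<tau>' t" "\<tau>' t \<le> 2" "t \<notin> {0<..<1} \<Longrightarrow> \<tau>' t = 0" for t
    by (auto simp: \<tau>'_def max_def)
  have \<tau>01: "\<tau> 0 = 0" "\<tau> 1 = 1"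
    by (simp_all add: \<tau>_def power2_eq_square)
  have \<tau>_in: "\<tau> t \<in> {0..1}" for t
  proof -
    have "\<tau> 0 \<le> \<tau> t \<or> \<tau> t = 0" "\<tau> t \<le> \<tau> 1 \<or> \<tau> t = 1"
    proof -
      show "\<tau> 0 \<le> \<tau> t \<or> \<tau> t = 0"
      proof (cases "0 \<le> t")
        case True
        then show ?thesis
          using \<tau> \<tau>'_bounds(1) by (intro disjI1 DERIV_nonneg_imp_nondecreasing[of 0 t \<tau>]) auto
      qed (simp add: \<tau>_def)
      show "\<tau> t \<le> \<tau> 1 \<or> \<tau> t = 1"
      proof (cases "t \<le> 1")
        case True
        then show ?thesis
          using \<tau> \<tau>'_bounds(1) by (intro disjI1 DERIV_nonneg_imp_nondecreasing[of t 1 \<tau>]) auto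
      qed (simp add: \<tau>_def power2_eq_square algebra_simps)
    qed
    then show ?thesis using \<tau>01 by auto
  qed
  define X where "X t x = \<tau>' t *\<^sub>R Y x" for t x
  have "control W (2 * \<bar>L\<bar> + 1) X"
    unfolding control_def
  proof (intro conjI allI impI)
    show "continuous_on UNIV (\<lambda>t. X t x)" for x
      unfolding X_def \<tau>'_def by (intro continuous_intros)
    show "norm (X t x - X t y) \<le> (2 * \<bar>L\<bar> + 1) * norm (x - y)" for t x y
    proof -
      have "norm (X t x - X t y) = \<tau>' t * norm (Y x - Y y)"
        using \<tau>'_bounds(1) by (simp add: X_def flip: scaleR_diff_right)
      also have "\<dots> \<le> 2 * (\<bar>L\<bar> * norm (x - y))"
        using \<tau>'_bounds by (intro mult_mono order_trans[OF lip] mult_right_mono) auto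
      also have "\<dots> \<le> (2 * \<bar>L\<bar> + 1) * norm (x - y)"
        by (simp add: algebra_simps)
      finally show ?thesis .
    qed
    show "X t x = 0" if "t \<notin> {0<..<1} \<or> x \<notin> W" for t x
      using that \<tau>'_bounds(3)[of t] zero by (auto simp: X_def)
  qed simp
  then obtain \<phi> where \<phi>W: "steer W \<phi>" and \<phi>: "\<And>u. trajectory X u \<Longrightarrow> \<phi> (u 0) = u 1"
    by (rule control_imp_steer) blast
  have "\<phi> (v 0) = v 1"
    if v: "\<forall>s\<in>{0..1}. (v has_vector_derivative Y (v s)) (at s)" for v
  proof -
    have "(v \<circ> \<tau> has_vector_derivative \<tau>' t *\<^sub>R Y (v (\<tau> t))) (at t)" for t
      by (rule vector_diff_chain_at) (use \<tau> v \<tau>_in in \<open>auto simp flip: has_real_derivative_iff_has_vector_derivative\<close>)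
    then have "trajectory X (v \<circ> \<tau>)"
      by (simp add: trajectory_def X_def)
    from \<phi>[OF this] show ?thesis by (simp add: \<tau>01)
  qed
  with \<phi>W show ?thesis by blast
qed

text \<open>The distance to the complement of \<open>W\<close>, divided by a lower bound
  \<open>r\<close> for it on \<open>K\<close> and truncated at 1. The complement must be nonempty,
  as the distance to the empty set is 0 by convention.\<close>

lemma lipschitz_cutoff:
  fixes K W :: "'a::euclidean_space set"
  assumes "compact K" "open W" "K \<subseteq> W" "W \<noteq> UNIV"
  obtains \<rho> :: "'a \<Rightarrow> real" and L where "L \<ge> 0" "\<And>x. 0 \<le> \<rho> x" "\<And>x. \<rho> x \<le> 1" "\<And>x. x \<in> K \<Longrightarrow> \<rho> x = 1"
    "\<And>x. x \<notin> W \<Longrightarrow> \<rho> x = 0" "\<And>x y. \<bar>\<rho> x - \<rho> y\<bar> \<le> L * norm (x - y)"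
proof -
  obtain r where r: "r > 0" "(\<Union>x\<in>K. ball x r) \<subseteq> W"
    using compact_subset_open_imp_ball_epsilon_subset[OF assms(1-3)] by blast
  define \<rho> where "\<rho> x = min 1 (infdist x (- W) / r)" for x
  show ?thesis
  proof (rule that)
    show "0 \<le> 1 / r" "0 \<le> \<rho> x" "\<rho> x \<le> 1" for x using r by (auto simp: \<rho>_def infdist_nonneg)
    show "\<rho> x = 1" if "x \<in> K" for x
    proof -
      have "r \<le> infdist x (- W)"
        using r that \<open>W \<noteq> UNIV\<close>
        by (subst infdist_notempty, blast, intro cINF_greatest) (auto simp: subset_iff ball_def intro: leI)
      then show ?thesis using r by (simp add: \<rho>_def)
    qed
    show "\<rho> x = 0" if "x \<notin> W" for x
      using that by (simp add: \<rho>_def)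
    show "\<bar>\<rho> x - \<rho> y\<bar> \<le> 1 / r * norm (x - y)" for x y
    proof -
      have "\<bar>\<rho> x - \<rho> y\<bar> \<le> \<bar>infdist x (- W) / r - infdist y (- W) / r\<bar>"
        by (auto simp: \<rho>_def min_def)
      also have "\<dots> = \<bar>infdist x (- W) - infdist y (- W)\<bar> / r"
        using r by (simp flip: diff_divide_distrib)
      also have "\<dots> \<le> dist x y / r"
        using r infdist_triangle_abs[of x "- W" y] by (simp add: divide_right_mono)
      finally show ?thesis by (simp add: dist_norm)
    qed
  qed
qed

text \<open>Multiplying by a cutoff changes nothing on \<open>K\<close>, so explicit solutions that
  stay in \<open>K\<close> for unit time survive. The bound \<open>C\<close> is what keeps the
  product of two Lipschitz functions Lipschitz.\<close>

lemma steer_cutoff: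
  fixes f :: "'a \<Rightarrow> 'a::euclidean_space"
  assumes K: "compact K" "open W" "K \<subseteq> W" "W \<noteq> UNIV"
    and lip: "\<And>x y. norm (f x - f y) \<le> M * norm (x - y)" and bdd: "\<And>x. norm (f x) \<le> C"
  shows "\<exists>\<phi>. steer W \<phi> \<and>
    (\<forall>v. (\<forall>s\<in>{0..1}. v s \<in> K \<and> (v has_vector_derivative f (v s)) (at s)) \<longrightarrow> \<phi> (v 0) = v 1)"
proof -
  obtain \<rho> :: "'a \<Rightarrow> real" and L where \<rho>: "L \<ge> 0" "\<And>x. 0 \<le> \<rho> x" "\<And>x. \<rho> x \<le> 1" "\<And>x. x \<in> K \<Longrightarrow> \<rho> x = 1"
    "\<And>x. x \<notin> W \<Longrightarrow> \<rho> x = 0" "\<And>x y. \<bar>\<rho> x - \<rho> y\<bar> \<le> L * norm (x - y)"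
    by (rule lipschitz_cutoff[OF K]) blast
  define Y where "Y x = \<rho> x *\<^sub>R f x" for x
  have "norm (Y x - Y y) \<le> (L * C + \<bar>M\<bar>) * norm (x - y)" for x y
  proof -
    have "Y x - Y y = (\<rho> x - \<rho> y) *\<^sub>R f x + \<rho> y *\<^sub>R (f x - f y)"
      by (simp add: Y_def algebra_simps)
    then have "norm (Y x - Y y) \<le> \<bar>\<rho> x - \<rho> y\<bar> * norm (f x) + \<rho> y * norm (f x - f y)"
      using norm_triangle_ineq[of "(\<rho> x - \<rho> y) *\<^sub>R f x" "\<rho> y *\<^sub>R (f x - f y)"] \<rho>(2)[of y] by simp
    also have "\<dots> \<le> (L * norm (x - y)) * C + 1 * (\<bar>M\<bar> * norm (x - y))"
      using \<rho>(1,2,3,6) bdd by (intro add_mono mult_mono order_trans[OF lip] mult_right_mono) auto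
    finally show ?thesis by (simp add: algebra_simps)
  qed
  moreover have "Y x = 0" if "x \<notin> W" for x
    using \<rho>(5)[OF that] by (simp add: Y_def)
  ultimately have "\<exists>\<phi>. steer W \<phi> \<and>
    (\<forall>v. (\<forall>s\<in>{0..1}. (v has_vector_derivative Y (v s)) (at s)) \<longrightarrow> \<phi> (v 0) = v 1)"
    by (rule steer_autonomous)
  then show ?thesis
    using \<rho>(4) by (auto simp: Y_def)
qed

section \<open>Contraction into a ball and transport of finitely many points\<close>

text \<open>The linear field pointing to \<open>p\<close> shrinks distances to \<open>p\<close>
  exponentially. Composing it with the nearest-point projection onto the hull \<open>H\<close>,
  which is 1-Lipschitz, makes it globally bounded without altering it on \<open>H\<close>, where the
  trajectories from \<open>K\<close> remain by convexity.\<close>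

lemma steer_compress:
  fixes K :: "'a::euclidean_space set"
  assumes K: "compact K" "K \<subseteq> W" and W: "open W" "convex W" "bounded W" and p: "p \<in> W" and "0 < r"
  obtains \<phi> where "steer W \<phi>" "\<phi> ` K \<subseteq> ball p r"
proof -
  define H where "H = convex hull (insert p K)"
  have H: "compact H" "H \<subseteq> W" "convex H" "p \<in> H" "K \<subseteq> H"
    using K W p by (auto simp: H_def compact_convex_hull hull_minimal hull_inc subset_hull)
  have WU: "W \<noteq> UNIV" using W(3) not_bounded_UNIV by auto
  have Hne: "H \<noteq> {}" and Hcl: "closed H"
    using H by (auto simp: compact_imp_closed)
  have "bounded ((\<lambda>x. x - p) ` H)"
    using H(1) by (intro compact_imp_bounded compact_continuous_image continuous_intros)
  then obtain D where D: "0 < D" "\<And>x. x \<in> H \<Longrightarrow> norm (x - p) \<le> D"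
    unfolding bounded_pos by auto
  \<comment> \<open>This rate suffices because exp(D/r) > D/r, hence exp(-k) D < r.\<close>
  define k where "k = D / r"
  have k: "0 \<le> k" "exp (- k) * D < r"
  proof -
    show "0 \<le> k" using D \<open>0 < r\<close> by (simp add: k_def)
    have "D / r < exp (D / r)"
      using exp_ge_add_one_self[of "D / r"] by linarith
    then show "exp (- k) * D < r"
      using \<open>0 < r\<close> by (simp add: k_def exp_minus field_simps)
  qed
  define f where "f z = k *\<^sub>R (p - closest_point H z)" for z
  have "norm (f x - f y) \<le> k * norm (x - y)" for x y
  proof -
    have "norm (f x - f y) = k * dist (closest_point H x) (closest_point H y)"
      using k(1) by (simp add: f_def dist_norm norm_minus_commute flip: scaleR_diff_right)
    then show ?thesis
      using closest_point_lipschitz[OF H(3) Hcl Hne, of x y] k(1) by (simp add: mult_left_mono dist_norm)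
  qed
  moreover have "norm (f x) \<le> k * D" for x
    using D(2)[OF closest_point_in_set[OF Hcl Hne, of x]] k(1)
    by (simp add: f_def norm_minus_commute mult_left_mono)
  ultimately obtain \<phi> where \<phi>: "steer W \<phi>"
    "\<forall>v. (\<forall>s\<in>{0..1}. v s \<in> H \<and> (v has_vector_derivative f (v s)) (at s)) \<longrightarrow> \<phi> (v 0) = v 1"
    using steer_cutoff[OF H(1) W(1) H(2) WU, of f k "k * D"] by auto
  have "\<phi> x \<in> ball p r" if "x \<in> K" for x
  proof -
    define v where "v s = p + exp (- k * s) *\<^sub>R (x - p)" for s
    have x: "x \<in> H" using that H by auto
    have "v s \<in> H" if "s \<in> {0..1}" for s
    proof -
      have "v s = (1 - exp (- k * s)) *\<^sub>R p + exp (- k * s) *\<^sub>R x"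
        by (simp add: v_def algebra_simps)
      then show ?thesis
        using convexD[OF H(3,4) x, of "1 - exp (- k * s)" "exp (- k * s)"] that k(1) by simp
    qed
    moreover have "(v has_vector_derivative f (v s)) (at s)" if "v s \<in> H" for s
    proof -
      have "((\<lambda>s. exp (- k * s)) has_real_derivative - k * exp (- k * s)) (at s)"
        by (auto intro!: derivative_eq_intros)
      then have "(v has_vector_derivative 0 + (exp (- k * s) *\<^sub>R 0 + (- k * exp (- k * s)) *\<^sub>R (x - p))) (at s)"
        unfolding v_def
        by (intro has_vector_derivative_add has_vector_derivative_scaleR has_vector_derivative_const)
      moreover have "f (v s) = (- k * exp (- k * s)) *\<^sub>R (x - p)"
        unfolding f_def closest_point_self[OF that] by (simp add: v_def)
      ultimately show ?thesis by simp
    qed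
    ultimately have "\<phi> (v 0) = v 1" using \<phi>(2) by blast
    then have "dist p (\<phi> x) = exp (- k) * norm (x - p)"
      by (simp add: v_def dist_norm norm_minus_commute)
    also have "\<dots> \<le> exp (- k) * D"
      using D(2)[OF x] by simp
    finally show ?thesis using k by simp
  qed
  then show ?thesis using \<phi>(1) that by blast
qed

text \<open>Reachability from \<open>a\<close> is a local property: within a ball in
  \<open>W\<close>, a point is moved to any other along a segment by a constant field that is cut
  off near the segment. Connectedness then propagates reachability through \<open>W\<close>.\<close>

lemma steer_point:
  fixes W :: "'a::euclidean_space set"
  assumes W: "open W" "connected W" "W \<noteq> UNIV" and "a \<in> W" "b \<in> W"
  shows "\<exists>\<phi>. steer W \<phi> \<and> \<phi> a = b"
proof (rule connected_induction_simple[OF \<open>connected W\<close> \<open>a \<in> W\<close> \<open>b \<in> W\<close>])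
  show "\<exists>\<phi>. steer W \<phi> \<and> \<phi> a = a"
    by (intro exI[of _ "\<lambda>x. x"] conjI steer_id refl)
  fix c assume "c \<in> W"
  then obtain r where r: "r > 0" "ball c r \<subseteq> W"
    using \<open>open W\<close> open_contains_ball by blast
  have "\<exists>\<phi>. steer W \<phi> \<and> \<phi> a = y"
    if xy: "x \<in> ball c r" "y \<in> ball c r" and x: "\<exists>\<phi>. steer W \<phi> \<and> \<phi> a = x" for x y
  proof -
    obtain \<phi> where \<phi>: "steer W \<phi>" "\<phi> a = x" using x by (elim exE conjE)
    have "closed_segment x y \<subseteq> W"
      using closed_segment_subset[OF xy convex_ball] r(2) by (rule subset_trans)
    then have "\<exists>\<psi>. steer W \<psi> \<and>
      (\<forall>v. (\<forall>s\<in>{0..1}. v s \<in> closed_segment x y \<and> (v has_vector_derivative (y - x)) (at s)) \<longrightarrow> \<psi> (v 0) = v 1)"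
      by (rule steer_cutoff[OF compact_segment W(1) _ W(3), of x y _ 0 "norm (y - x)"]) simp_all
    then obtain \<psi> where \<psi>: "steer W \<psi>"
      "\<forall>v. (\<forall>s\<in>{0..1}. v s \<in> closed_segment x y \<and> (v has_vector_derivative (y - x)) (at s)) \<longrightarrow> \<psi> (v 0) = v 1"
      by (elim exE conjE)
    \<comment> \<open>The unreduced coefficients 0 and 1 let unification find the curve
      \<open>\<lambda>s. x + s *\<^sub>R (y - x)\<close>.\<close>
    have "\<psi> (x + 0 *\<^sub>R (y - x)) = x + 1 *\<^sub>R (y - x)"
      by (rule \<psi>(2)[rule_format]) (auto simp: in_segment algebra_simps intro!: derivative_eq_intros)
    then show ?thesis
      by (intro exI[of _ "\<psi> \<circ> \<phi>"] conjI steer_comp \<phi>(1) \<psi>(1)) (simp add: \<phi>(2))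
  qed
  then show "\<exists>T. openin (top_of_set W) T \<and> c \<in> T \<and>
      (\<forall>x\<in>T. \<forall>y\<in>T. (\<exists>\<phi>. steer W \<phi> \<and> \<phi> a = x) \<longrightarrow> (\<exists>\<phi>. steer W \<phi> \<and> \<phi> a = y))"
  proof (intro exI[of _ "ball c r"] conjI ballI impI)
    show "openin (top_of_set W) (ball c r)"
      using r(2) \<open>open W\<close> by (simp add: openin_open_eq)
    show "c \<in> ball c r"
      using r(1) by simp
  qed
qed

text \<open>The targets are hit one at a time. For a new target the steering takes place in
  \<open>V - Q\<close>, so the targets already hit stay fixed; in dimension at least 2 this set is
  still connected. By injectivity the image of \<open>A\<close> stays infinite, so it has a point
  outside \<open>Q\<close> to be moved.\<close>

lemma steer_cover_finite:
  fixes V :: "'a::euclidean_space set"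
  assumes V: "open V" "connected V" "V \<noteq> UNIV" and dim: "2 \<le> DIM('a)"
    and A: "infinite A" "A \<subseteq> V" and Q: "finite Q" "Q \<subseteq> V"
  shows "\<exists>\<phi>. steer V \<phi> \<and> Q \<subseteq> \<phi> ` A"
  using Q
proof (induction Q rule: finite_induct)
  case empty
  show ?case by (intro exI[of _ "\<lambda>x. x"] conjI steer_id) simp
next
  case (insert q Q)
  then have "\<exists>\<phi>. steer V \<phi> \<and> Q \<subseteq> \<phi> ` A" by simp
  then obtain \<phi> where \<phi>: "steer V \<phi>" "Q \<subseteq> \<phi> ` A" by (elim exE conjE)
  have "infinite (\<phi> ` A)"
    using A(1) inj_on_subset[OF steer_inj[OF \<phi>(1)], of A] by (simp add: finite_image_iff)
  then have "\<not> \<phi> ` A \<subseteq> Q"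
    using finite_subset[OF _ insert.hyps(1)] by blast
  then obtain a where a: "a \<in> A" "\<phi> a \<notin> Q"
    by auto
  have "\<phi> a \<in> V" using steer_maps[OF \<phi>(1), of a] a A by auto
  moreover have "connected (V - Q)" "open (V - Q)" "V - Q \<noteq> UNIV"
    using V by (auto intro!: connected_open_delete_finite dim insert.hyps(1) open_Diff finite_imp_closed)
  ultimately obtain \<psi> where \<psi>: "steer (V - Q) \<psi>" "\<psi> (\<phi> a) = q"
    using steer_point[of "V - Q" "\<phi> a" q] a insert.prems insert.hyps(2) by auto
  have "insert q Q \<subseteq> (\<psi> \<circ> \<phi>) ` A"
  proof
    fix z assume "z \<in> insert q Q"
    then consider "z = q" | "z \<in> Q" by blast
    then show "z \<in> (\<psi> \<circ> \<phi>) ` A"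
    proof cases
      case 1
      then show ?thesis using \<psi>(2) a(1) by force
    next
      case 2
      then obtain b where "b \<in> A" "z = \<phi> b" using \<phi>(2) by blast
      then show ?thesis using steer_fixes[OF \<psi>(1), of z] 2 by force
    qed
  qed
  then show ?case
    using steer_mono[OF \<psi>(1)]
    by (intro exI[of _ "\<psi> \<circ> \<phi>"] conjI steer_comp \<phi>(1)) auto
qed

section \<open>Bernstein approximation of vector fields\<close>

text \<open>In the product case the factors must also be bounded on \<open>S\<close>; this follows
  from their Lipschitz estimates and the boundedness of \<open>S\<close>.\<close>

lemma real_polynomial_function_lipschitz:
  assumes "real_polynomial_function f" and S: "bounded S"
  shows "\<exists>L. \<forall>x\<in>S. \<forall>y\<in>S. \<bar>f x - f y\<bar> \<le> L * norm (x - y)"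
  using assms(1)
proof (induction f rule: real_polynomial_function.induct)
  case (linear f)
  then obtain K where K: "\<And>x. norm (f x) \<le> norm x * K"
    using bounded_linear.bounded by blast
  have "\<bar>f x - f y\<bar> \<le> K * norm (x - y)" for x y
    using K[of "x - y"] linear by (simp add: bounded_linear.linear linear_diff mult.commute)
  then show ?case by blast
next
  case (const c)
  then show ?case by (intro exI[of _ 0]) auto
next
  case (add f g)
  then obtain L M where LM: "\<forall>x\<in>S. \<forall>y\<in>S. \<bar>f x - f y\<bar> \<le> L * norm (x - y)" "\<forall>x\<in>S. \<forall>y\<in>S. \<bar>g x - g y\<bar> \<le> M * norm (x - y)"
    by (elim exE)
  have "\<bar>f x + g x - (f y + g y)\<bar> \<le> (L + M) * norm (x - y)" if "x \<in> S" "y \<in> S" for x y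
    using LM[rule_format, OF that] by (simp add: algebra_simps abs_le_iff)
  then show ?case by blast
next
  case (mult f g)
  then obtain L M where LM: "\<forall>x\<in>S. \<forall>y\<in>S. \<bar>f x - f y\<bar> \<le> L * norm (x - y)" "\<forall>x\<in>S. \<forall>y\<in>S. \<bar>g x - g y\<bar> \<le> M * norm (x - y)"
    by (elim exE)
  have bdd: "\<exists>b>0. \<forall>x\<in>S. \<bar>h x\<bar> \<le> b" if h: "\<forall>x\<in>S. \<forall>y\<in>S. \<bar>h x - h y\<bar> \<le> K * norm (x - y)" for h :: "_ \<Rightarrow> real" and K
  proof (cases "S = {}")
    case False
    then obtain a where a: "a \<in> S" by blast
    obtain B where B: "\<And>x. x \<in> S \<Longrightarrow> norm x \<le> B" using S bounded_iff by metis
    have "\<bar>h x\<bar> \<le> \<bar>K\<bar> * (2 * \<bar>B\<bar>) + \<bar>h a\<bar> + 1" if x: "x \<in> S" for x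
    proof -
      have "\<bar>h x - h a\<bar> \<le> K * norm (x - a)" using h x a by blast
      also have "\<dots> \<le> \<bar>K\<bar> * norm (x - a)" by (intro mult_right_mono) auto
      also have "\<dots> \<le> \<bar>K\<bar> * (2 * \<bar>B\<bar>)"
        using norm_triangle_ineq4[of x a] B[OF x] B[OF a] by (intro mult_left_mono) auto
      finally show ?thesis by linarith
    qed
    then show ?thesis by (intro exI[of _ "\<bar>K\<bar> * (2 * \<bar>B\<bar>) + \<bar>h a\<bar> + 1"]) (auto intro: add_nonneg_pos)
  qed (auto intro: exI[of _ 1])
  obtain a where a: "a > 0" "\<forall>x\<in>S. \<bar>f x\<bar> \<le> a" using bdd[OF LM(1)] by blast
  obtain b where b: "b > 0" "\<forall>x\<in>S. \<bar>g x\<bar> \<le> b" using bdd[OF LM(2)] by blast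
  have "\<bar>f x * g x - f y * g y\<bar> \<le> (L * b + a * M) * norm (x - y)" if "x \<in> S" "y \<in> S" for x y
  proof -
    have "\<bar>f x * g x - f y * g y\<bar> = \<bar>(f x - f y) * g x + f y * (g x - g y)\<bar>"
      by (simp add: algebra_simps)
    also have "\<dots> \<le> \<bar>f x - f y\<bar> * \<bar>g x\<bar> + \<bar>f y\<bar> * \<bar>g x - g y\<bar>"
      using abs_triangle_ineq by (metis abs_mult)
    also have "\<dots> \<le> (L * norm (x - y)) * b + a * (M * norm (x - y))"
      using LM[rule_format, OF that] a b that
      by (intro add_mono mult_mono) (auto intro: order_trans[OF abs_ge_zero])
    finally show ?thesis by (simp add: algebra_simps)
  qed
  then show ?case by blast
qed

lemma real_polynomial_function_Bernstein:
  assumes "real_polynomial_function f"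
  shows "real_polynomial_function (\<lambda>x. Bernstein n i (f x))"
  unfolding Bernstein_def
  by (intro real_polynomial_function.intros(2,4) real_polynomial_function_power real_polynomial_function_diff assms)

text \<open>One constant serves all times because continuous coefficients are bounded on [0,1].
  Allowing any bounded \<open>S\<close> covers the closed cube as well as solutions not known to
  stay inside it.\<close>

lemma ffd_lipschitz:
  fixes \<alpha> :: "nat \<Rightarrow> nat \<Rightarrow> nat \<Rightarrow> real \<Rightarrow> real^3"
  assumes cont: "\<And>i j k. i \<le> m \<Longrightarrow> j \<le> n \<Longrightarrow> k \<le> l \<Longrightarrow> continuous_on {0..1} (\<alpha> i j k)" and S: "bounded S"
  shows "\<exists>L\<ge>0. \<forall>t\<in>{0..1}. \<forall>x\<in>S. \<forall>y\<in>S.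
    norm (ffd m n l (\<lambda>i j k. \<alpha> i j k t) x - ffd m n l (\<lambda>i j k. \<alpha> i j k t) y) \<le> L * norm (x - y)"
proof -
  define B where "B i j k x = Bernstein m i (x$1) * Bernstein n j (x$2) * Bernstein l k (x$3)" for i j k and x :: "real^3"
  have "real_polynomial_function (B i j k)" for i j k
    unfolding B_def
    by (intro real_polynomial_function.intros(1,4) real_polynomial_function_Bernstein bounded_linear_vec_nth)
  then have "\<exists>L. \<forall>x\<in>S. \<forall>y\<in>S. \<bar>B i j k x - B i j k y\<bar> \<le> L * norm (x - y)" for i j k
    by (rule real_polynomial_function_lipschitz) (rule S)
  then obtain L where L: "\<And>i j k x y. x \<in> S \<Longrightarrow> y \<in> S \<Longrightarrow> \<bar>B i j k x - B i j k y\<bar> \<le> L i j k * norm (x - y)"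
    by metis
  have "\<exists>M\<ge>0. \<forall>t\<in>{0..1}. norm (\<alpha> i j k t) \<le> M" if "i \<le> m" "j \<le> n" "k \<le> l" for i j k
  proof -
    have "bounded (\<alpha> i j k ` {0..1})"
      by (intro compact_imp_bounded compact_continuous_image cont that compact_Icc)
    then show ?thesis unfolding bounded_pos by (auto intro: less_imp_le)
  qed
  then obtain M where M: "\<And>i j k t. i \<le> m \<Longrightarrow> j \<le> n \<Longrightarrow> k \<le> l \<Longrightarrow> 0 \<le> M i j k \<and> (t \<in> {0..1} \<longrightarrow> norm (\<alpha> i j k t) \<le> M i j k)"
    by metis
  define R where "R = (\<Sum>i\<le>m. \<Sum>j\<le>n. \<Sum>k\<le>l. \<bar>L i j k\<bar> * M i j k)"
  have "0 \<le> R"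
    unfolding R_def using M by (intro sum_nonneg mult_nonneg_nonneg) auto
  moreover have "norm (ffd m n l (\<lambda>i j k. \<alpha> i j k t) x - ffd m n l (\<lambda>i j k. \<alpha> i j k t) y) \<le> R * norm (x - y)"
    if t: "t \<in> {0..1}" and x: "x \<in> S" and y: "y \<in> S" for t x y
  proof -
    have "norm (ffd m n l (\<lambda>i j k. \<alpha> i j k t) x - ffd m n l (\<lambda>i j k. \<alpha> i j k t) y)
        = norm (\<Sum>i\<le>m. \<Sum>j\<le>n. \<Sum>k\<le>l. (B i j k x - B i j k y) *\<^sub>R \<alpha> i j k t)"
      by (simp add: ffd_def B_def scaleR_diff_left sum_subtractf)
    also have "\<dots> \<le> (\<Sum>i\<le>m. \<Sum>j\<le>n. \<Sum>k\<le>l. (\<bar>L i j k\<bar> * norm (x - y)) * M i j k)"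
    proof (intro sum_norm_le)
      fix i j k assume "i \<in> {..m}" "j \<in> {..n}" "k \<in> {..l}"
      then have "norm (\<alpha> i j k t) \<le> M i j k" using M t by auto
      moreover have "\<bar>B i j k x - B i j k y\<bar> \<le> \<bar>L i j k\<bar> * norm (x - y)"
        using L[OF x y, of i j k] by (rule order_trans) (auto intro: mult_right_mono)
      ultimately show "norm ((B i j k x - B i j k y) *\<^sub>R \<alpha> i j k t) \<le> (\<bar>L i j k\<bar> * norm (x - y)) * M i j k"
        by (simp add: mult_mono)
    qed
    also have "\<dots> = R * norm (x - y)"
      by (simp add: R_def sum_distrib_left sum_distrib_right mult_ac)
    finally show ?thesis .
  qed
  ultimately show ?thesis by blast
qed

section \<open>Quantitative Bernstein approximation on the cube\<close>

text \<open>The Bernstein weights form the binomial distribution, and k/n has mean x and variance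
  x(1-x)/n \<le> 1/n. The bound on the mean absolute deviation follows from that on the
  variance.\<close>

lemma Bernstein_mean_deviation:
  assumes x: "0 \<le> x" "x \<le> 1" and n: "1 \<le> n"
  shows "(\<Sum>k\<le>n. \<bar>real k / real n - x\<bar> * Bernstein n k x) \<le> 1 / sqrt (real n)"
proof -
  have n0: "real n > 0" using n by simp
  \<comment> \<open>The square is expanded in k(k-1), k and 1, whose Bernstein sums are known in
    closed form.\<close>
  have "(\<Sum>k\<le>n. (real k / real n - x)\<^sup>2 * Bernstein n k x)
      = (\<Sum>k\<le>n. (real k * (real k - 1) * Bernstein n k x) / (real n)\<^sup>2
          + (1 / (real n)\<^sup>2 - 2 * x / real n) * (real k * Bernstein n k x) + x\<^sup>2 * Bernstein n k x)"
    using n0 by (intro sum.cong) (auto simp: field_simps power2_eq_square)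
  also have "\<dots> = real n * (real n - 1) * x\<^sup>2 / (real n)\<^sup>2 + (1 / (real n)\<^sup>2 - 2 * x / real n) * (real n * x) + x\<^sup>2"
    by (simp add: sum.distrib flip: sum_distrib_left sum_divide_distrib)
  also have "\<dots> = x * (1 - x) / real n"
    using n0 by (simp add: field_simps power2_eq_square)
  also have "\<dots> \<le> 1 / real n"
    using x mult_le_one[of x "1 - x"] by (simp add: divide_right_mono)
  finally have var: "(\<Sum>k\<le>n. (real k / real n - x)\<^sup>2 * Bernstein n k x) \<le> 1 / real n" .
  \<comment> \<open>This pointwise bound replaces Cauchy-Schwarz; the weight sqrt n balances its two
    terms when d^2 is about 1/n.\<close>
  have amgm: "\<bar>d\<bar> \<le> (sqrt (real n) * d\<^sup>2 + 1 / sqrt (real n)) / 2" for d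
  proof -
    define s where "s = sqrt (real n)"
    have s: "s > 0" using n0 by (simp add: s_def)
    have "0 \<le> (s * \<bar>d\<bar> - 1)\<^sup>2" by simp
    then show ?thesis
      unfolding s_def[symmetric] using s by (simp add: field_simps power2_eq_square)
  qed
  have "(\<Sum>k\<le>n. \<bar>real k / real n - x\<bar> * Bernstein n k x)
      \<le> (\<Sum>k\<le>n. ((sqrt (real n) * (real k / real n - x)\<^sup>2 + 1 / sqrt (real n)) / 2) * Bernstein n k x)"
    using x by (intro sum_mono mult_right_mono amgm Bernstein_nonneg)
  also have "\<dots> = (\<Sum>k\<le>n. sqrt (real n) / 2 * ((real k / real n - x)\<^sup>2 * Bernstein n k x) + 1 / (2 * sqrt (real n)) * Bernstein n k x)"
    by (intro sum.cong) (auto simp: field_simps)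
  also have "\<dots> = sqrt (real n) / 2 * (\<Sum>k\<le>n. (real k / real n - x)\<^sup>2 * Bernstein n k x) + 1 / (2 * sqrt (real n))"
    by (simp add: sum.distrib flip: sum_distrib_left sum_divide_distrib)
  also have "\<dots> \<le> sqrt (real n) / 2 * (1 / real n) + 1 / (2 * sqrt (real n))"
    using var by (intro add_right_mono mult_left_mono) auto
  also have "sqrt (real n) / 2 * (1 / real n) = 1 / (2 * sqrt (real n))"
    using n0 real_sqrt_mult_self[of "real n"] by (simp add: field_simps)
  finally show ?thesis by simp
qed

abbreviation (input) grid_point :: "nat \<Rightarrow> nat \<Rightarrow> nat \<Rightarrow> nat \<Rightarrow> real^3" where
  "grid_point n i j k \<equiv> vector [real i / real n, real j / real n, real k / real n]"

text \<open>The FFD value is the expectation of \<open>f\<close> at a random grid point with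
  independent binomial coordinates. The Lipschitz bound and the l1 norm split the error into one
  mean deviation per coordinate.\<close>

lemma ffd_grid_approximation:
  fixes f :: "real^3 \<Rightarrow> real^3"
  assumes lip: "\<And>x y. norm (f x - f y) \<le> L * norm (x - y)" and L: "0 \<le> L" and n: "1 \<le> n"
    and x: "\<And>c. 0 \<le> x $ c \<and> x $ c \<le> 1"
  shows "norm (ffd n n n (\<lambda>i j k. f (grid_point n i j k)) x - f x) \<le> 3 * L / sqrt (real n)"
proof -
  define b where "b c i = Bernstein n i (x $ c)" for c i
  define d where "d c i = \<bar>real i / real n - x $ c\<bar>" for c i
  have b: "0 \<le> b c i" "(\<Sum>i\<le>n. b c i) = 1" "(\<Sum>i\<le>n. d c i * b c i) \<le> 1 / sqrt (real n)" for c i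
    using x Bernstein_mean_deviation[OF _ _ n] by (auto simp: b_def d_def Bernstein_nonneg)
  have "f x = (\<Sum>i\<le>n. \<Sum>j\<le>n. \<Sum>k\<le>n. (b 1 i * b 2 j * b 3 k) *\<^sub>R f x)"
    by (simp add: b(2) flip: scaleR_sum_left sum_distrib_left)
  then have "norm (ffd n n n (\<lambda>i j k. f (grid_point n i j k)) x - f x)
      = norm (\<Sum>i\<le>n. \<Sum>j\<le>n. \<Sum>k\<le>n. (b 1 i * b 2 j * b 3 k) *\<^sub>R (f (grid_point n i j k) - f x))"
    by (simp add: ffd_def b_def scaleR_diff_right sum_subtractf)
  also have "\<dots> \<le> (\<Sum>i\<le>n. \<Sum>j\<le>n. \<Sum>k\<le>n. (b 1 i * b 2 j * b 3 k) * (L * (d 1 i + d 2 j + d 3 k)))"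
  proof (intro sum_norm_le)
    fix i j k
    have "norm (f (grid_point n i j k) - f x) \<le> L * norm (grid_point n i j k - x)" by (rule lip)
    also have "\<dots> \<le> L * (d 1 i + d 2 j + d 3 k)"
      using L norm_le_l1_cart[of "grid_point n i j k - x"]
      by (intro mult_left_mono) (simp_all add: sum_3 d_def)
    finally show "norm ((b 1 i * b 2 j * b 3 k) *\<^sub>R (f (grid_point n i j k) - f x))
        \<le> (b 1 i * b 2 j * b 3 k) * (L * (d 1 i + d 2 j + d 3 k))"
      using b(1) by (simp add: mult_left_mono)
  qed
  also have "\<dots> = L * ((\<Sum>i\<le>n. d 1 i * b 1 i) + (\<Sum>j\<le>n. d 2 j * b 2 j) + (\<Sum>k\<le>n. d 3 k * b 3 k))"
  proof -
    \<comment> \<open>The triple sum is marginalized from the innermost index outwards; each time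
      the weights of the summed index add up to 1.\<close>
    have k: "(\<Sum>k\<le>n. b 1 i * b 2 j * b 3 k * (L * (d 1 i + d 2 j + d 3 k)))
        = L * (b 1 i * (b 2 j * (d 1 i + d 2 j + (\<Sum>k\<le>n. d 3 k * b 3 k))))" for i j
    proof -
      have "(\<Sum>k\<le>n. b 1 i * b 2 j * b 3 k * (L * (d 1 i + d 2 j + d 3 k)))
          = (\<Sum>k\<le>n. L * (b 1 i * b 2 j * (d 1 i + d 2 j)) * b 3 k + L * (b 1 i * b 2 j) * (d 3 k * b 3 k))"
        by (intro sum.cong) (auto simp: algebra_simps)
      also have "\<dots> = L * (b 1 i * b 2 j * (d 1 i + d 2 j)) + L * (b 1 i * b 2 j) * (\<Sum>k\<le>n. d 3 k * b 3 k)"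
        by (simp add: sum.distrib b(2) flip: sum_distrib_left)
      finally show ?thesis by (simp add: algebra_simps)
    qed
    have j: "(\<Sum>j\<le>n. b 2 j * (d 1 i + d 2 j + e)) = d 1 i + (\<Sum>j\<le>n. d 2 j * b 2 j) + e" for i e
    proof -
      have "(\<Sum>j\<le>n. b 2 j * (d 1 i + d 2 j + e)) = (\<Sum>j\<le>n. (d 1 i + e) * b 2 j + d 2 j * b 2 j)"
        by (intro sum.cong) (auto simp: algebra_simps)
      then show ?thesis by (simp add: sum.distrib b(2) flip: sum_distrib_left)
    qed
    have i: "(\<Sum>i\<le>n. b 1 i * (d 1 i + e + e')) = (\<Sum>i\<le>n. d 1 i * b 1 i) + e + e'" for e e'
    proof -
      have "(\<Sum>i\<le>n. b 1 i * (d 1 i + e + e')) = (\<Sum>i\<le>n. (e + e') * b 1 i + d 1 i * b 1 i)"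
        by (intro sum.cong) (auto simp: algebra_simps)
      then show ?thesis by (simp add: sum.distrib b(2) flip: sum_distrib_left)
    qed
    show ?thesis
      by (simp only: k sum_distrib_left[symmetric] j i)
  qed
  also have "\<dots> \<le> L * (1 / sqrt (real n) + 1 / sqrt (real n) + 1 / sqrt (real n))"
    using L b(3) by (intro mult_left_mono add_mono)
  finally show ?thesis by (simp add: mult.commute)
qed

section \<open>FFD fields that vanish on the boundary of the cube\<close>

lemma Bernstein_zero: "Bernstein n i 0 = (if i = 0 then 1 else 0)"
  by (simp add: Bernstein_def)

lemma Bernstein_one: "i \<le> n \<Longrightarrow> Bernstein n i 1 = (if i = n then 1 else 0)"
  by (auto simp: Bernstein_def)

text \<open>At 0 and at 1 only the first and the last Bernstein polynomial, respectively, is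
  nonzero, so only boundary coefficients contribute there.\<close>

lemma ffd_boundary:
  assumes \<delta>: "\<And>i j k. i \<le> m \<Longrightarrow> j \<le> n \<Longrightarrow> k \<le> l \<Longrightarrow> i * (m - i) * (j * (n - j)) * (k * (l - k)) = 0 \<Longrightarrow> \<delta> i j k = 0"
    and x: "x $ c = 0 \<or> x $ c = 1"
  shows "ffd m n l \<delta> x = 0"
  unfolding ffd_def
proof (intro sum.neutral ballI)
  fix i j k assume ijk: "i \<in> {..m}" "j \<in> {..n}" "k \<in> {..l}"
  have "c = 1 \<or> c = 2 \<or> c = 3" by (rule exhaust_3)
  with x ijk show "(Bernstein m i (x $ 1) * Bernstein n j (x $ 2) * Bernstein l k (x $ 3)) *\<^sub>R \<delta> i j k = 0"
    by (elim disjE) (auto simp: Bernstein_zero Bernstein_one intro!: \<delta>)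
qed

abbreviation (input) unit_cube :: "(real^3) set" where
  "unit_cube \<equiv> {x. \<forall>c. 0 < x$c \<and> x$c < 1}"

text \<open>The coefficients sample the control field at the grid points. To reuse the theory of
  control fields, the FFD field is evaluated at the point clamped to the cube: this agrees with the
  FFD field inside the cube and vanishes outside.\<close>

lemma ffd_approximates_steer:
  assumes "steer unit_cube \<phi>" and \<delta>: "0 < \<delta>"
  shows "\<exists>n \<alpha>. 1 \<le> n \<and> (\<forall>i j k. continuous_on {0..1} (\<alpha> i j k)) \<and>
    (\<forall>i\<le>n. \<forall>j\<le>n. \<forall>k\<le>n. i * (n - i) * (j * (n - j)) * (k * (n - k)) = 0 \<longrightarrow> (\<forall>t. \<alpha> i j k t = 0)) \<and>
    (\<forall>x\<in>unit_cube. ffd_well_posed n n n \<alpha> x \<and> dist (ffd_flow n n n \<alpha> x) (\<phi> x) < \<delta>)"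
proof -
  obtain L X where X: "control unit_cube L X" and \<phi>: "\<forall>x. \<exists>u. trajectory X u \<and> u 0 = x \<and> u 1 = \<phi> x"
    using assms(1) by (rule steerE)
  have L: "0 < L" by (rule controlD(1)[OF X])
  \<comment> \<open>Chosen so that the field error \<open>e\<close> below, amplified by Gronwall
    over unit time, stays under \<open>\<delta>\<close>.\<close>
  obtain n :: nat where n: "(3 * L)\<^sup>2 * exp (2 * L + 1) / \<delta>\<^sup>2 < real n"
    using reals_Archimedean2 by blast
  have "0 < real n"
    by (rule le_less_trans[OF _ n]) simp
  then have n1: "1 \<le> n" by simp
  define \<alpha> where "\<alpha> i j k t = X t (grid_point n i j k)" for i j k t
  define e where "e = 3 * L / sqrt (real n)"
  have e: "0 \<le> e" "e\<^sup>2 * exp (2 * L + 1) < \<delta>\<^sup>2"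
    using L n n1 \<delta> by (simp_all add: e_def power_divide divide_less_eq mult.commute)
  have bd: "\<alpha> i j k t = 0" if "i \<le> n" "j \<le> n" "k \<le> n" "i * (n - i) * (j * (n - j)) * (k * (n - k)) = 0" for i j k t
  proof -
    have "grid_point n i j k \<notin> unit_cube"
    proof -
      \<comment> \<open>For indices up to \<open>n\<close> the truncated difference n - i is 0
        exactly at i = n, so the grid point has a coordinate equal to 0 or 1.\<close>
      from that have "i = 0 \<or> i = n \<or> j = 0 \<or> j = n \<or> k = 0 \<or> k = n" by auto
      then show ?thesis using n1 by (auto simp: forall_3)
    qed
    then show ?thesis unfolding \<alpha>_def by (rule controlD(5)[OF X])
  qed
  have cont: "continuous_on T (\<alpha> i j k)" for T i j k
    unfolding \<alpha>_def by (rule continuous_on_subset[OF controlD(2)[OF X]]) simp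
  define cl :: "real^3 \<Rightarrow> real^3" where "cl x = (\<chi> c. max 0 (min 1 (x $ c)))" for x
  have cl_lip: "norm (cl x - cl y) \<le> norm (x - y)" for x y
    by (rule norm_le_componentwise_cart) (auto simp: cl_def max_def min_def)
  have cl_bounds: "0 \<le> cl x $ c" "cl x $ c \<le> 1" for x c
    by (simp_all add: cl_def)
  have cl_id: "cl x = x" if "x \<in> unit_cube" for x
    using that by (simp add: cl_def vec_eq_iff max_absorb2 min_absorb2 less_imp_le)
  have cl_boundary: "\<exists>c. cl x $ c = 0 \<or> cl x $ c = 1" if "x \<notin> unit_cube" for x
  proof -
    from that obtain c where "x $ c \<le> 0 \<or> 1 \<le> x $ c" by (auto simp: not_less)
    then show ?thesis by (intro exI[of _ c]) (auto simp: cl_def)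
  qed
  define P where "P t x = ffd n n n (\<lambda>i j k. \<alpha> i j k t) (cl x)" for t x
  have P_boundary: "P t x = 0" if "x \<notin> unit_cube" for t x
    using cl_boundary[OF that] unfolding P_def by (elim exE) (rule ffd_boundary, rule bd)
  have P_time: "P t x = 0" if "t \<notin> {0<..<1}" for t x
    using controlD(4)[OF X that] by (simp add: P_def ffd_def \<alpha>_def)
  obtain M where M: "M \<ge> 0" "\<And>t x y. t \<in> {0..1} \<Longrightarrow> norm (P t x - P t y) \<le> M * norm (cl x - cl y)"
  proof -
    have "bounded (range cl)"
      by (rule bounded_subset[OF bounded_cbox[of 0 1]]) (auto simp: mem_box_cart cl_bounds)
    then have "\<exists>M\<ge>0. \<forall>t\<in>{0..1}. \<forall>x\<in>range cl. \<forall>y\<in>range cl.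
        norm (ffd n n n (\<lambda>i j k. \<alpha> i j k t) x - ffd n n n (\<lambda>i j k. \<alpha> i j k t) y) \<le> M * norm (x - y)"
      by (intro ffd_lipschitz cont)
    then obtain M where M: "0 \<le> M" "\<forall>t\<in>{0..1}. \<forall>x\<in>range cl. \<forall>y\<in>range cl.
        norm (ffd n n n (\<lambda>i j k. \<alpha> i j k t) x - ffd n n n (\<lambda>i j k. \<alpha> i j k t) y) \<le> M * norm (x - y)"
      by (elim exE conjE)
    show ?thesis
      by (rule that[OF M(1)]) (simp add: P_def M(2)[rule_format])
  qed
  have P: "control unit_cube (M + 1) P"
    unfolding control_def
  proof (intro conjI allI impI)
    show "0 < M + 1" using M(1) by simp
    show "continuous_on UNIV (\<lambda>t. P t x)" for x
      unfolding P_def ffd_def by (intro continuous_intros cont)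
    show "norm (P t x - P t y) \<le> (M + 1) * norm (x - y)" for t x y
    proof (cases "t \<in> {0..1}")
      case True
      have "norm (P t x - P t y) \<le> M * norm (x - y)"
        using M(2)[OF True] mult_left_mono[OF cl_lip M(1)] by (rule order_trans)
      also have "\<dots> \<le> (M + 1) * norm (x - y)"
        by (rule mult_right_mono) simp_all
      finally show ?thesis .
    next
      case False
      then have "t \<notin> {0<..<1}" by auto
      then show ?thesis using P_time M(1) by simp
    qed
    show "P t x = 0" if "t \<notin> {0<..<1} \<or> x \<notin> unit_cube" for t x
      using that by (elim disjE) (rule P_time P_boundary, assumption)+
  qed
  have approx: "norm (P t x - X t x) \<le> e" for t x
  proof (cases "x \<in> unit_cube")
    case True
    then show ?thesis
      unfolding P_def cl_id[OF True] \<alpha>_def e_def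
      by (intro ffd_grid_approximation controlD(3)[OF X] n1) (use L in \<open>auto intro: less_imp_le\<close>)
  next
    case False
    then show ?thesis using P_boundary controlD(5)[OF X] e(1) by simp
  qed
  have main: "ffd_well_posed n n n \<alpha> x \<and> dist (ffd_flow n n n \<alpha> x) (\<phi> x) < \<delta>" if x: "x \<in> unit_cube" for x
  proof -
    obtain u where u: "trajectory P u" "u 0 = x"
      using trajectory_exists[OF P, of x] by (elim exE conjE)
    \<comment> \<open>Inside the cube clamping is the identity, so the trajectory of
      \<open>P\<close> solves the FFD equation itself.\<close>
    have uC: "u t \<in> unit_cube" for t
      using trajectory_stays[OF P u(1), of 0 t] x u(2) by simp
    have du: "(u has_vector_derivative ffd n n n (\<lambda>i j k. \<alpha> i j k t) (u t)) (at t within T)" for t T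
      using u(1) cl_id[OF uC] by (simp add: trajectory_def P_def has_vector_derivative_at_within)
    have sol: "ffd_solution n n n \<alpha> x u"
      unfolding ffd_solution_def using u(2) du by simp
    \<comment> \<open>A competing solution lives on [0,1] only and might leave the cube, so
      uniqueness for \<open>P\<close> does not apply. Gronwall is used with a Lipschitz constant of
      the FFD field on the bounded set swept out by both curves.\<close>
    have uniq: "v t = u t" if v: "ffd_solution n n n \<alpha> x v" and t: "t \<in> {0..1}" for v t
    proof -
      have dv: "(v has_vector_derivative ffd n n n (\<lambda>i j k. \<alpha> i j k s) (v s)) (at s within {0..1})" if "s \<in> {0..1}" for s
        using v that unfolding ffd_solution_def by blast
      have "continuous_on {0..1} v" "continuous_on {0..1} u"
        unfolding continuous_on_eq_continuous_within
        using has_vector_derivative_continuous[OF dv] has_vector_derivative_continuous[OF du] by simp_all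
      then have "bounded (u ` {0..1} \<union> v ` {0..1})"
        by (simp add: compact_imp_bounded compact_continuous_image)
      then have "\<exists>K\<ge>0. \<forall>s\<in>{0..1}. \<forall>x\<in>u ` {0..1} \<union> v ` {0..1}. \<forall>y\<in>u ` {0..1} \<union> v ` {0..1}.
          norm (ffd n n n (\<lambda>i j k. \<alpha> i j k s) x - ffd n n n (\<lambda>i j k. \<alpha> i j k s) y) \<le> K * norm (x - y)"
        by (intro ffd_lipschitz cont)
      then obtain K where K: "K \<ge> 0" "\<forall>s\<in>{0..1}. \<forall>x\<in>u ` {0..1} \<union> v ` {0..1}. \<forall>y\<in>u ` {0..1} \<union> v ` {0..1}.
          norm (ffd n n n (\<lambda>i j k. \<alpha> i j k s) x - ffd n n n (\<lambda>i j k. \<alpha> i j k s) y) \<le> K * norm (x - y)"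
        by (elim exE conjE)
      have sub: "{0..t} \<subseteq> {0..1}" using t by auto
      have "(norm (v t - u t))\<^sup>2 \<le> ((norm (v 0 - u 0))\<^sup>2 + 0\<^sup>2) * exp ((2 * K + 1) * (t - 0))"
      proof (rule gronwall_forward[OF _ K(1)])
        show "(v has_vector_derivative ffd n n n (\<lambda>i j k. \<alpha> i j k s) (v s)) (at s within {0..t})" if "s \<in> {0..t}" for s
          by (rule has_vector_derivative_within_subset[OF dv sub]) (use that sub in auto)
        show "norm (ffd n n n (\<lambda>i j k. \<alpha> i j k s) (v s) - ffd n n n (\<lambda>i j k. \<alpha> i j k s) (u s))
            \<le> K * norm (v s - u s) + 0" if "s \<in> {0..t}" for s
        proof -
          have "s \<in> {0..1}" using that sub by auto
          then show ?thesis using K(2) by simp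
        qed
      qed (use t du in simp_all)
      moreover have "v 0 = u 0" using v u(2) by (simp add: ffd_solution_def)
      ultimately show ?thesis by simp
    qed
    have "ffd_flow n n n \<alpha> x = u 1"
      unfolding ffd_flow_def
    proof (rule the_equality)
      show "\<exists>w. ffd_solution n n n \<alpha> x w \<and> w 1 = u 1" using sol by (intro exI[of _ u] conjI refl)
      fix y assume "\<exists>w. ffd_solution n n n \<alpha> x w \<and> w 1 = y"
      then obtain w where "ffd_solution n n n \<alpha> x w" "w 1 = y" by (elim exE conjE)
      then show "y = u 1" using uniq[of w 1] by simp
    qed
    \<comment> \<open>The comparison passes through \<open>X t (u t)\<close>, so the exponent
      contains the constant \<open>L\<close> of \<open>X\<close> and not \<open>M\<close>, which may
      grow with \<open>n\<close>.\<close>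
    moreover have "norm (u 1 - \<phi> x) < \<delta>"
    proof -
      obtain w where w: "trajectory X w" "w 0 = x" "w 1 = \<phi> x"
        using \<phi> by (elim allE[of _ x] exE conjE)
      have "(norm (u 1 - w 1))\<^sup>2 \<le> ((norm (u 0 - w 0))\<^sup>2 + e\<^sup>2) * exp ((2 * L + 1) * (1 - 0))"
      proof (rule gronwall_forward[where u' = "\<lambda>t. P t (u t)" and v' = "\<lambda>t. X t (w t)"])
        show "norm (P t (u t) - X t (w t)) \<le> L * norm (u t - w t) + e" for t
          using approx[of t "u t"] controlD(3)[OF X, of t "u t" "w t"]
            norm_triangle_ineq[of "P t (u t) - X t (u t)" "X t (u t) - X t (w t)"] by simp
      qed (use u(1) w(1) L in \<open>simp_all add: trajectory_def has_vector_derivative_at_within\<close>)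
      then have "(norm (u 1 - \<phi> x))\<^sup>2 < \<delta>\<^sup>2"
        using e(2) u(2) w by simp
      then show ?thesis using \<delta> by (simp add: power_less_imp_less_base)
    qed
    moreover have "ffd_well_posed n n n \<alpha> x"
      unfolding ffd_well_posed_def using sol uniq by (intro exI[of _ u] conjI allI impI ballI)
    ultimately show ?thesis by (simp add: dist_norm)
  qed
  show ?thesis
  proof (intro exI[of _ n] exI[of _ \<alpha>] conjI)
    show "\<forall>i j k. continuous_on {0..1} (\<alpha> i j k)"
      by (intro allI cont)
    show "\<forall>i\<le>n. \<forall>j\<le>n. \<forall>k\<le>n. i * (n - i) * (j * (n - j)) * (k * (n - k)) = 0 \<longrightarrow> (\<forall>t. \<alpha> i j k t = 0)"
      by (intro allI impI bd)
    show "\<forall>x\<in>unit_cube. ffd_well_posed n n n \<alpha> x \<and> dist (ffd_flow n n n \<alpha> x) (\<phi> x) < \<delta>"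
      by (intro ballI main)
  qed (rule n1)
qed

section \<open>Chamfer distance and Hausdorff closeness\<close>

text \<open>
  This holds for an arbitrary measure \<open>M\<close>: a nonintegrable numerator or denominator has integral 0,
  and division by 0 gives 0. Hence nothing about the surface measure is needed below.
\<close>

lemma set_average_le:
  fixes f :: "'a \<Rightarrow> real"
  assumes f: "\<And>x. x \<in> S \<Longrightarrow> f x \<le> B" and B: "0 \<le> B"
  shows "(LINT x:S|M. f x) / (LINT x:S|M. 1) \<le> B"
proof (cases "set_integrable M S f \<and> set_integrable M S (\<lambda>_. 1 :: real)")
  case True
  have nn: "0 \<le> (LINT x:S|M. 1 :: real)"
    unfolding set_lebesgue_integral_def by (intro integral_nonneg_AE) (simp add: indicator_def)
  have "(LINT x:S|M. f x) \<le> (LINT x:S|M. B * 1)"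
    using True f by (intro set_integral_mono) (auto simp: set_integrable_def mult.left_commute)
  also have "\<dots> = B * (LINT x:S|M. 1)"
    by (rule set_integral_mult_right)
  finally show ?thesis using nn B by (cases "(LINT x:S|M. 1 :: real) = 0") (auto simp: divide_le_eq)
next
  case False
  then have "(LINT x:S|M. f x) = 0 \<or> (LINT x:S|M. 1 :: real) = 0"
    unfolding set_integrable_def set_lebesgue_integral_def
    using not_integrable_integral_eq[of M "\<lambda>x. indicator S x *\<^sub>R f x"]
      not_integrable_integral_eq[of M "\<lambda>x. indicator S x *\<^sub>R (1::real)"] by blast
  then show ?thesis using B by auto
qed

lemma chamfer_dist_le:
  assumes "\<And>x. x \<in> S \<Longrightarrow> infdist x S' \<le> d" "\<And>x. x \<in> S' \<Longrightarrow> infdist x S \<le> d" "0 \<le> d"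
  shows "chamfer_dist S S' \<le> d\<^sup>2"
proof -
  have "(LINT x:S|surface_measure S. (infdist x S')\<^sup>2) / (LINT x:S|surface_measure S. 1) \<le> d\<^sup>2"
    by (rule set_average_le) (auto intro: power_mono assms infdist_nonneg)
  moreover have "(LINT x:S'|surface_measure S'. (infdist x S)\<^sup>2) / (LINT x:S'|surface_measure S'. 1) \<le> d\<^sup>2"
    by (rule set_average_le) (auto intro: power_mono assms infdist_nonneg)
  ultimately show ?thesis unfolding chamfer_dist_def by linarith
qed


section \<open>Steering one compact set close to another\<close>

text \<open>Convexity of \<open>W\<close> makes each \<open>ball p r \<inter> W\<close> connected.
  Attached to \<open>S\<close>, these pieces all share the connected set \<open>S\<close>.\<close>

lemma connected_neighbourhood:
  fixes S W :: "'a::real_normed_vector set"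
  assumes S: "connected S" "S \<subseteq> W" and W: "convex W" and r: "0 < r"
  shows "connected ((\<Union>p\<in>S. ball p r) \<inter> W)"
proof -
  have "connected (\<Union>p\<in>S. S \<union> (ball p r \<inter> W))"
  proof (cases "S = {}")
    case False
    show ?thesis
    proof (rule connected_Union, safe)
      show "connected (S \<union> (ball p r \<inter> W))" if "p \<in> S" for p
      proof (rule connected_Un)
        show "connected (ball p r \<inter> W)"
          by (intro convex_connected convex_Int convex_ball W)
        show "S \<inter> (ball p r \<inter> W) \<noteq> {}"
          using that S r by auto
      qed (rule S)
      show False if "\<Inter> ((\<lambda>p. S \<union> (ball p r \<inter> W)) ` S) = {}"
        using that False by blast
    qed
  qed simp
  also have "(\<Union>p\<in>S. S \<union> (ball p r \<inter> W)) = (\<Union>p\<in>S. ball p r) \<inter> W"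
    using S r by auto
  finally show ?thesis .
qed

text \<open>The two estimates have different sources: invariance of \<open>V\<close> keeps the image
  of \<open>S\<close> near \<open>T\<close>, while hitting every point of the finite net
  \<open>Q\<close> brings the image near each point of \<open>T\<close>.\<close>

lemma steer_close:
  fixes S T :: "'a::euclidean_space set"
  assumes dim: "2 \<le> DIM('a)" and W: "open W" "convex W" "bounded W"
    and S: "compact S" "infinite S" "S \<subseteq> W"
    and T: "compact T" "connected T" "T \<noteq> {}" "T \<subseteq> W" and r: "0 < r"
  shows "\<exists>\<phi>. steer W \<phi> \<and> (\<forall>x\<in>S. infdist (\<phi> x) T < r) \<and> (\<forall>y\<in>T. \<exists>x\<in>S. dist y (\<phi> x) < r)"
proof -
  define V where "V = (\<Union>p\<in>T. ball p r) \<inter> W"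
  have V: "open V" "connected V" "T \<subseteq> V" "V \<subseteq> W"
    using W T r connected_neighbourhood[of T W r] by (auto simp: V_def)
  have "W \<noteq> UNIV" using W(3) not_bounded_UNIV by auto
  then have VU: "V \<noteq> UNIV" using V(4) by auto
  obtain p where p: "p \<in> T" using T(3) by blast
  then have "p \<in> V" using V(3) by blast
  then obtain s where s: "0 < s" "ball p s \<subseteq> V"
    by (rule openE[OF V(1)])
  have "p \<in> W" using p T(4) by blast
  obtain \<phi> where \<phi>: "steer W \<phi>" "\<phi> ` S \<subseteq> ball p s"
    by (rule steer_compress[OF S(1,3) W \<open>p \<in> W\<close> s(1)])
  have A: "infinite (\<phi> ` S)" "\<phi> ` S \<subseteq> V"
    using S(2) inj_on_subset[OF steer_inj[OF \<phi>(1)], of S] \<phi>(2) s(2) by (auto simp: finite_image_iff)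
  obtain Q where Q: "finite Q" "Q \<subseteq> T" "T \<subseteq> (\<Union>q\<in>Q. ball q r)"
    using seq_compact_imp_totally_bounded[OF compact_imp_seq_compact[OF T(1)], rule_format, OF r]
    by (elim exE conjE)
  obtain \<psi> where \<psi>: "steer V \<psi>" "Q \<subseteq> \<psi> ` \<phi> ` S"
    using steer_cover_finite[OF V(1,2) VU dim A Q(1) subset_trans[OF Q(2) V(3)]] by (elim exE conjE)
  have "infdist ((\<psi> \<circ> \<phi>) x) T < r" if "x \<in> S" for x
  proof -
    have "\<psi> (\<phi> x) \<in> V"
      using A(2) that by (intro steer_maps[OF \<psi>(1)]) auto
    then obtain q where "q \<in> T" "dist (\<psi> (\<phi> x)) q < r"
      by (auto simp: V_def dist_commute)
    then show ?thesis
      using infdist_le[of q T "\<psi> (\<phi> x)"] by simp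
  qed
  moreover have "\<exists>x\<in>S. dist y ((\<psi> \<circ> \<phi>) x) < r" if "y \<in> T" for y
  proof -
    from Q(3) that have "y \<in> (\<Union>q\<in>Q. ball q r)" by blast
    then obtain q where "q \<in> Q" "dist y q < r"
      by (auto simp: dist_commute)
    then show ?thesis using \<psi>(2) by auto
  qed
  ultimately show ?thesis
    using steer_comp[OF \<phi>(1) steer_mono[OF \<psi>(1) V(4)]] by (intro exI[of _ "\<psi> \<circ> \<phi>"] conjI) auto
qed

text \<open>Infinitude of the first surface supplies a point for each point of the net;
  connectedness of the second makes its neighbourhood connected. The sphere is infinite since a
  finite connected set has at most one point, while two axis vectors lie on the sphere.\<close>

lemma genus_zero_imp_infinite_connected:
  assumes "genus_zero S"
  shows "infinite S" "connected S"
proof -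
  have "infinite (sphere (0::real^3) 1)"
  proof
    assume "finite (sphere (0::real^3) 1)"
    then obtain a where a: "sphere (0::real^3) 1 \<subseteq> {a}"
      using connected_finite_iff_sing[OF connected_sphere[of "0::real^3" 1]] by auto
    have "axis 1 1 \<in> sphere (0::real^3) 1" "axis 2 1 \<in> sphere (0::real^3) 1"
      by auto
    from this[THEN subsetD[OF a]] have "axis 1 1 = (axis 2 1 :: real^3)"
      by (simp only: singleton_iff)
    then show False by (simp add: axis_eq_axis)
  qed
  moreover have "sphere (0::real^3) 1 homeomorphic S"
    using assms unfolding genus_zero_def by (subst homeomorphic_sym)
  ultimately show "infinite S"
    using homeomorphic_finite[of S "sphere (0::real^3) 1"] by blast
  show "connected S"
    using assms homeomorphic_connectedness connected_sphere[of "0::real^3" 1] unfolding genus_zero_def by auto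
qed

text \<open>Well-posedness at every point of \<open>S\<^sub>1\<close> is part of the conclusion
  because \<open>ffd_flow\<close> is defined by \<open>THE\<close>; it guarantees that the image is
  taken under the actual time-one map. All three degrees are chosen equal.\<close>

theorem theorem2:
  fixes S\<^sub>1 S\<^sub>2 :: "(real^3) set" and \<epsilon> :: real
  assumes "closed_smooth_surface S\<^sub>1" and "genus_zero S\<^sub>1"
    and "S\<^sub>1 \<subseteq> {x. \<forall>c. 0 < x$c \<and> x$c < 1}"
    and "closed_smooth_surface S\<^sub>2" and "genus_zero S\<^sub>2"
    and "S\<^sub>2 \<subseteq> {x. \<forall>c. 0 < x$c \<and> x$c < 1}"
    and "\<epsilon> > 0"
  shows "\<exists>m n l. \<exists>\<alpha> :: nat \<Rightarrow> nat \<Rightarrow> nat \<Rightarrow> real \<Rightarrow> real^3.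
           m \<ge> 1 \<and> n \<ge> 1 \<and> l \<ge> 1 \<and>
           (\<forall>i\<le>m. \<forall>j\<le>n. \<forall>k\<le>l. continuous_on {0..1} (\<alpha> i j k)) \<and>
           (\<forall>x\<in>S\<^sub>1. ffd_well_posed m n l \<alpha> x) \<and>
           chamfer_dist (ffd_flow m n l \<alpha> ` S\<^sub>1) S\<^sub>2 \<le> \<epsilon> \<and>
           (\<forall>i\<le>m. \<forall>j\<le>n. \<forall>k\<le>l.
              i * (m - i) * (j * (n - j)) * (k * (l - k)) = 0 \<longrightarrow> (\<forall>t\<in>{0..1}. \<alpha> i j k t = 0))"
proof -
  \<comment> \<open>The steering and its approximation by an FFD flow each cost less than
    \<open>d\<close>, and the squared total is at most \<open>\<epsilon>\<close>.\<close>
  define d where "d = sqrt \<epsilon> / 2"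
  have d: "0 < d" "(2 * d)\<^sup>2 = \<epsilon>"
    using assms(7) by (simp_all add: d_def)
  have cube: "unit_cube = box 0 1"
    by (auto simp: mem_box_cart)
  have "open unit_cube" "convex unit_cube" "bounded unit_cube"
    unfolding cube by (simp_all add: open_box convex_box bounded_box)
  moreover have "S\<^sub>2 \<noteq> {}"
    using genus_zero_imp_infinite_connected(1)[OF assms(5)] by auto
  ultimately have "\<exists>\<phi>. steer unit_cube \<phi> \<and> (\<forall>x\<in>S\<^sub>1. infdist (\<phi> x) S\<^sub>2 < d) \<and> (\<forall>y\<in>S\<^sub>2. \<exists>x\<in>S\<^sub>1. dist y (\<phi> x) < d)"
    using assms d(1) genus_zero_imp_infinite_connected unfolding closed_smooth_surface_def by (intro steer_close) auto
  then obtain \<phi> where \<phi>: "steer unit_cube \<phi>" "\<forall>x\<in>S\<^sub>1. infdist (\<phi> x) S\<^sub>2 < d"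
    "\<forall>y\<in>S\<^sub>2. \<exists>x\<in>S\<^sub>1. dist y (\<phi> x) < d"
    by (elim exE conjE)
  obtain n \<alpha> where n: "1 \<le> n" and cont: "\<forall>i j k. continuous_on {0..1} (\<alpha> i j k)"
    and bd: "\<forall>i\<le>n. \<forall>j\<le>n. \<forall>k\<le>n. i * (n - i) * (j * (n - j)) * (k * (n - k)) = 0 \<longrightarrow> (\<forall>t. \<alpha> i j k t = 0)"
    and wp: "\<forall>x\<in>unit_cube. ffd_well_posed n n n \<alpha> x \<and> dist (ffd_flow n n n \<alpha> x) (\<phi> x) < d"
    using ffd_approximates_steer[OF \<phi>(1) d(1)] by (elim exE conjE)
  define G where "G = ffd_flow n n n \<alpha>"
  have G: "dist (G x) (\<phi> x) < d" if "x \<in> S\<^sub>1" for x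
    using wp assms(3) that by (auto simp: G_def)
  have "chamfer_dist (G ` S\<^sub>1) S\<^sub>2 \<le> (2 * d)\<^sup>2"
  proof (rule chamfer_dist_le)
    fix z assume "z \<in> G ` S\<^sub>1"
    then obtain x where x: "x \<in> S\<^sub>1" "z = G x" by blast
    show "infdist z S\<^sub>2 \<le> 2 * d"
      using infdist_triangle[of z S\<^sub>2 "\<phi> x"] G[OF x(1)] \<phi>(2) x by fastforce
  next
    fix y assume "y \<in> S\<^sub>2"
    then obtain x where x: "x \<in> S\<^sub>1" "dist y (\<phi> x) < d" using \<phi>(3) by blast
    then have "dist y (G x) \<le> 2 * d"
      using dist_triangle[of y "G x" "\<phi> x"] G[OF x(1)] by (simp add: dist_commute)
    then show "infdist y (G ` S\<^sub>1) \<le> 2 * d"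
      using infdist_le[of "G x" "G ` S\<^sub>1" y] x(1) by force
  qed (use d(1) in simp)
  then have "chamfer_dist (ffd_flow n n n \<alpha> ` S\<^sub>1) S\<^sub>2 \<le> \<epsilon>"
    unfolding G_def d(2) .
  moreover have "\<forall>x\<in>S\<^sub>1. ffd_well_posed n n n \<alpha> x"
    using wp assms(3) by blast
  ultimately show ?thesis
    using n cont bd by (intro exI[of _ n] exI[of _ \<alpha>] conjI) auto
qed

end
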